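(* Suppose $\mathcal Q$ is vertically unbounded, $s_\infty=1$ and $v(p)\in H$. Then $J=\emptyset$, i.e. $B=\{0,1,\dots,D\}$.
   Context: Let $(K,v)$ be a valued field and $p$ the characteristic exponent of its residue field ($p=1$ if the residue characteristic is $0$, otherwise $p$ is the residue characteristic); $v(p)$ denotes the value of $p\cdot1\in K$ (so $v(p)=\infty$ if $\mathrm{char}K=p>0$). Let $\Gamma$ be the divisible hull of $vK$, embedded in a divisible ordered abelian group $\Lambda$. Let $\nu\colon K[x]\to\Lambda\cup\{\infty\}$ be a valuation extending $v$ which is well-specified, i.e. it is not the case that simultaneously $\nu^{-1}(\infty)=0$, the value group of $\nu$ modulo $\Gamma$ is torsion, and the residue field of $\nu$ is algebraic over that of $v$. For $s\ge0$ let $\partial_s$ be the $s$-th Hasse–Schmidt derivative, defined by $f(x+y)=\sum_{s\ge0}(\partial_sf)y^s$. For nonconstant $f$ with $\nu(f)<\infty$ the level is $\epsilon_\nu(f)=\max\{(\nu(f)-\nu(\partial_sf))/s: s\ge1\}$ and $I(f)$ is the set of $s\ge1$ attaining the maximum; $\epsilon_\nu(a)=-\infty$ for $a\in K$. A monic $Q\in K[x]$ is a key polynomial for $\nu$ if $\epsilon_\nu(f)<\epsilon_\nu(Q)$ whenever $\deg f<\deg Q$. For monic $Q$, each $f$ has a unique $Q$-expansion $f=\sum_{i\ge0}f_{Q,i}Q^i$ with $\deg f_{Q,i}<\deg Q$; set $\nu_Q(f)=\min_i\nu(f_{Q,i}Q^i)$. Fix $m\ge1$ such that the set $\Psi_m$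 of key polynomials of degree $m$ for $\nu$ is nonempty and has no element of maximal $\nu$-value. Let $\mathcal Q\subseteq\Psi_m$ be well-ordered by $Q<R\iff\nu(Q)<\nu(R)$ and cofinal in $\Psi_m$ for $\nu$-values; write $\gamma_Q=\nu(Q)$. As in the paper, all values $\nu_Q(f)$ ($f\ne0$) lie in $\Gamma$. "For all $Q$ large enough" means for all $Q$ in a final segment of $\mathcal Q$. For all $Q$ large enough, $I(Q)=\{s_\infty\}$ for a fixed integer $s_\infty\ge1$. $f$ is $\mathcal Q$-stable if $\nu_Q(f)=\nu(f)$ for all $Q$ large enough, $\mathcal Q$-unstable otherwise. Assume unstable polynomials exist; limit key polynomials are the monic $\mathcal Q$-unstable polynomials of minimal degree, forming $\mathrm{KP}_\infty(\mathcal Q)$. Fix $F\in\mathrm{KP}_\infty(\mathcal Q)$, $D=\lfloor\deg F/m\rfloor$, $F=\sum_{\ell=0}^DF_{Q,\ell}Q^\ell$, $\beta_{Q,\ell}=\nu(F_{Q,\ell})\in\Gamma\cup\{\infty\}$. Let $\delta^L$ be the smallest initial segment of $\Gamma$ containing $\{\nu_Q(F):Q\in\mathcal Q\}$; write $x>\delta^L$ if $x\in(\Gamma\setminus\delta^L)\cup\{\infty\}$. Let $J$ be the set of $\ell\in\{0,\dots,D\}$ with $\beta_{Q,\ell}+\ell\gamma_Q>\delta^L$ for all $Q$ large enough, and $B=\{0,\dots,D\}\setminus J$. A cut $\eta=(\eta^L,\eta^R)$ of $\Gamma$ is vertically bounded if for every $x\in\eta^L$ and rational $q>1$ there is $y\in\eta^L$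 with $q(y-x)>z-x$ for all $z\in\eta^L$; its invariance group is $\{h\in\Gamma:h+\eta^L=\eta^L\}$. Let $\gamma_{\mathcal Q}$ be the cut whose lower set is the smallest initial segment of $\Gamma$ containing $\{\gamma_Q\}$; $\mathcal Q$ is vertically unbounded if $\gamma_{\mathcal Q}$ is not vertically bounded; $H$ is the invariance group of $\gamma_{\mathcal Q}$. *)

theory Defs
  imports "HOL-Library.Extended" "HOL-Computational_Algebra.Polynomial"
          "HOL-Computational_Algebra.Primes"
begin

(* Values live in a divisible ordered abelian group 'g (= Lambda); infinity is Pinf. *)

definition nmul :: "nat \<Rightarrow> 'g::ab_group_add \<Rightarrow> 'g" where
  "nmul n x = (\<Sum>i<n. x)"

definition divisible_grp :: "'g::linordered_ab_group_add itself \<Rightarrow> bool" where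
  "divisible_grp _ = (\<forall>(x::'g) n. n > 0 \<longrightarrow> (\<exists>y. nmul n y = x))"

(* the unique y with s*y = x (Lambda torsion free and divisible) *)
definition gdiv :: "'g::linordered_ab_group_add \<Rightarrow> nat \<Rightarrow> 'g" where
  "gdiv x s = (THE y. nmul s y = x)"

(* nu : K[x] -> Lambda \<union> {\<infinity>} is a valuation (possibly with nontrivial support) *)
definition is_valuation :: "('k::field poly \<Rightarrow> 'g::linordered_ab_group_add extended) \<Rightarrow> bool" where
  "is_valuation \<nu> \<longleftrightarrow> \<nu> 0 = Pinf \<and> \<nu> 1 = Fin 0 \<and> (\<forall>f. \<nu> f \<noteq> Minf)
     \<and> (\<forall>f g. \<nu> (f * g) = \<nu> f + \<nu> g) \<and> (\<forall>f g. min (\<nu> f) (\<nu> g) \<le> \<nu> (f + g))"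

(* value group vK of v = restriction of nu to constants *)
definition valgrp :: "('k::field poly \<Rightarrow> 'g::linordered_ab_group_add extended) \<Rightarrow> 'g set" where
  "valgrp \<nu> = {x. \<exists>a. a \<noteq> 0 \<and> \<nu> [:a:] = Fin x}"

definition Gamma :: "('k::field poly \<Rightarrow> 'g::linordered_ab_group_add extended) \<Rightarrow> 'g set" where
  "Gamma \<nu> = {x. \<exists>n>0. nmul n x \<in> valgrp \<nu>}"

(* characteristic exponent of the residue field of v *)
definition resexp :: "('k::field poly \<Rightarrow> 'g::linordered_ab_group_add extended) \<Rightarrow> nat" where
  "resexp \<nu> = (if \<exists>q::nat. prime q \<and> \<nu> (of_nat q) > 0
                then (THE q::nat. prime q \<and> \<nu> (of_nat q) > 0) else 1)"

definition val_torsion :: "('k::field poly \<Rightarrow> 'g::linordered_ab_group_add extended) \<Rightarrow> bool" where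
  "val_torsion \<nu> \<longleftrightarrow> (\<forall>f g. \<nu> f \<noteq> Pinf \<longrightarrow> \<nu> g \<noteq> Pinf \<longrightarrow>
      (\<exists>n>0. \<exists>x y. \<nu> f = Fin x \<and> \<nu> g = Fin y \<and> nmul n (x - y) \<in> Gamma \<nu>))"

(* residue field of nu is algebraic over the residue field of v:
   every residue class of f/g (nu g < \<infinity>, nu f \<ge> nu g) is a root of a nonzero
   polynomial with coefficients in the residue field of v *)
definition res_alg :: "('k::field poly \<Rightarrow> 'g::linordered_ab_group_add extended) \<Rightarrow> bool" where
  "res_alg \<nu> \<longleftrightarrow> (\<forall>f g. \<nu> g \<noteq> Pinf \<longrightarrow> \<nu> g \<le> \<nu> f \<longrightarrow>
     (\<exists>n a. (\<forall>i\<le>n. 0 \<le> \<nu> [:a i:]) \<and> (\<exists>i\<le>n. \<nu> [:a i:] = 0) \<and>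
        \<nu> (\<Sum>i\<le>n. smult (a i) (f ^ i * g ^ (n - i))) > \<nu> (g ^ n)))"

definition well_specified :: "('k::field poly \<Rightarrow> 'g::linordered_ab_group_add extended) \<Rightarrow> bool" where
  "well_specified \<nu> \<longleftrightarrow> \<not> ({f. \<nu> f = Pinf} = {0} \<and> val_torsion \<nu> \<and> res_alg \<nu>)"

(* Hasse-Schmidt derivative: f(x+y) = \<Sum>s (\<partial>_s f) y^s, read off as the coefficients
   of f(x+y) viewed as a polynomial in y over K[x] *)
definition hasse :: "nat \<Rightarrow> 'k::field poly \<Rightarrow> 'k poly" where
  "hasse s f = coeff (pcompose (map_poly (\<lambda>c. [:c:]) f) [: [:0, 1:], 1 :]) s"

definition lvl :: "('k::field poly \<Rightarrow> 'g::linordered_ab_group_add extended) \<Rightarrow> 'k poly \<Rightarrow> nat \<Rightarrow> 'g extended" where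
  "lvl \<nu> f s = (case \<nu> f of Fin a \<Rightarrow> (case \<nu> (hasse s f) of Fin b \<Rightarrow> Fin (gdiv (a - b) s) | _ \<Rightarrow> Minf)
                          | _ \<Rightarrow> Pinf)"

definition eps :: "('k::field poly \<Rightarrow> 'g::linordered_ab_group_add extended) \<Rightarrow> 'k poly \<Rightarrow> 'g extended" where
  "eps \<nu> f = (if degree f = 0 then Minf else if \<nu> f = Pinf then Pinf
             else Max (lvl \<nu> f ` {1..degree f}))"

definition Ilev :: "('k::field poly \<Rightarrow> 'g::linordered_ab_group_add extended) \<Rightarrow> 'k poly \<Rightarrow> nat set" where
  "Ilev \<nu> f = {s. 1 \<le> s \<and> \<nu> (hasse s f) \<noteq> Pinf \<and> lvl \<nu> f s = eps \<nu> f}"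

definition keypoly :: "('k::field poly \<Rightarrow> 'g::linordered_ab_group_add extended) \<Rightarrow> 'k poly \<Rightarrow> bool" where
  "keypoly \<nu> Q \<longleftrightarrow> lead_coeff Q = 1 \<and> (\<forall>f. degree f < degree Q \<longrightarrow> eps \<nu> f < eps \<nu> Q)"

definition Psi :: "('k::field poly \<Rightarrow> 'g::linordered_ab_group_add extended) \<Rightarrow> nat \<Rightarrow> 'k poly set" where
  "Psi \<nu> m = {Q. keypoly \<nu> Q \<and> degree Q = m}"

(* i-th coefficient f_{Q,i} of the Q-expansion of f *)
definition expc :: "'k::field poly \<Rightarrow> 'k poly \<Rightarrow> nat \<Rightarrow> 'k poly" where
  "expc Q f i = (f div Q ^ i) mod Q"

definition nuQ :: "('k::field poly \<Rightarrow> 'g::linordered_ab_group_add extended) \<Rightarrow> 'k poly \<Rightarrow> 'k poly \<Rightarrow> 'g extended" where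
  "nuQ \<nu> Q f = Min ((\<lambda>i. \<nu> (expc Q f i * Q ^ i)) ` {0..degree f})"

definition eventually_in :: "('k::field poly \<Rightarrow> 'g::linordered_ab_group_add extended) \<Rightarrow> 'k poly set \<Rightarrow> ('k poly \<Rightarrow> bool) \<Rightarrow> bool" where
  "eventually_in \<nu> Qs P \<longleftrightarrow> (\<exists>Q0\<in>Qs. \<forall>Q\<in>Qs. \<nu> Q0 \<le> \<nu> Q \<longrightarrow> P Q)"

definition stable :: "('k::field poly \<Rightarrow> 'g::linordered_ab_group_add extended) \<Rightarrow> 'k poly set \<Rightarrow> 'k poly \<Rightarrow> bool" where
  "stable \<nu> Qs f \<longleftrightarrow> eventually_in \<nu> Qs (\<lambda>Q. nuQ \<nu> Q f = \<nu> f)"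

definition deltaL :: "('k::field poly \<Rightarrow> 'g::linordered_ab_group_add extended) \<Rightarrow> 'k poly set \<Rightarrow> 'k poly \<Rightarrow> 'g set" where
  "deltaL \<nu> Qs F = {x \<in> Gamma \<nu>. \<exists>Q\<in>Qs. Fin x \<le> nuQ \<nu> Q F}"

definition above :: "('k::field poly \<Rightarrow> 'g::linordered_ab_group_add extended) \<Rightarrow> 'k poly set \<Rightarrow> 'k poly \<Rightarrow> 'g extended \<Rightarrow> bool" where
  "above \<nu> Qs F e \<longleftrightarrow> e = Pinf \<or> (\<exists>y. e = Fin y \<and> y \<in> Gamma \<nu> \<and> y \<notin> deltaL \<nu> Qs F)"

definition Jset :: "('k::field poly \<Rightarrow> 'g::linordered_ab_group_add extended) \<Rightarrow> 'k poly set \<Rightarrow> nat \<Rightarrow> 'k poly \<Rightarrow> nat set" where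
  "Jset \<nu> Qs m F = {l \<in> {0..degree F div m}.
      eventually_in \<nu> Qs (\<lambda>Q. above \<nu> Qs F (\<nu> (expc Q F l) + (\<Sum>i<l. \<nu> Q)))}"

definition gammaL :: "('k::field poly \<Rightarrow> 'g::linordered_ab_group_add extended) \<Rightarrow> 'k poly set \<Rightarrow> 'g set" where
  "gammaL \<nu> Qs = {x \<in> Gamma \<nu>. \<exists>Q\<in>Qs. Fin x \<le> \<nu> Q}"

(* cut with lower set L is vertically bounded; q = a/b > 1 rational *)
definition vert_bounded :: "'g::linordered_ab_group_add set \<Rightarrow> bool" where
  "vert_bounded L \<longleftrightarrow> (\<forall>x\<in>L. \<forall>a b::nat. 0 < b \<and> b < a \<longrightarrow>
      (\<exists>y\<in>L. \<forall>z\<in>L. nmul b (z - x) < nmul a (y - x)))"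

definition invgroup :: "'g::linordered_ab_group_add set \<Rightarrow> 'g set \<Rightarrow> 'g set" where
  "invgroup G L = {h \<in> G. (\<lambda>x. h + x) ` L = L}"

end

theory Submission
  imports Defs "HOL-Library.FuncSet"
begin

text \<open>
  Let \<open>D\<close> be the top index of the expansions of \<open>F\<close>. Minimality of \<open>deg F\<close> forces the top term
  \<open>F\<^bsub>P,D\<^esub> P\<^sup>D\<close> to lie below the cut for every \<open>P\<close>: otherwise the remainder of \<open>F\<close> modulo \<open>P\<^sup>D\<close>,
  which is stable, would have the same truncated values as \<open>F\<close> and make \<open>F\<close> stable. Fix \<open>l\<close>, a value
  \<open>\<delta>\<close> bounding those of all binomial coefficients involved, and a chain
  \<open>Q\<^sub>0 < Q\<^sub>1 < \<dots> < Q\<^sub>N < P\<close> whose values increase by more than \<open>\<delta>\<close> in each step; it exists because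
  \<open>v(p) \<in> H\<close>. Substituting \<open>P = Q\<^sub>i + h\<^sub>i\<close> in the \<open>P\<close>-expansion of \<open>F\<close> expresses \<open>F\<^bsub>Q\<^sub>i,l\<^esub>\<close> as
  \<open>\<Sum>\<^sub>j (l+j choose l) F\<^bsub>P,l+j\<^esub> h\<^sub>i\<^sup>j\<close> modulo \<open>Q\<^sub>i\<close>, up to carries whose values exceed those of
  the summands they come from by more than \<open>\<delta>\<close>. If \<open>N\<close> is large compared to \<open>D\<close>, then for some \<open>i\<close> a single summand has
  the smallest value by a margin larger than \<open>\<delta>\<close>. Hence the value of \<open>F\<^bsub>Q\<^sub>i,l\<^esub> Q\<^sub>i\<^sup>l\<close> exceeds that of
  \<open>F\<^bsub>P,D\<^esub> P\<^sup>D\<close> by at most \<open>\<delta>\<close>. Since the truncated values of the unstable \<open>F\<close> grow at least as fast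
  as those of the key polynomials, the cut is not crossed by adding \<open>\<delta>\<close>, so \<open>l \<notin> J\<close>.
\<close>

subsection \<open>Valuations on a polynomial ring\<close>

lemma nmul_0 [simp]: "nmul 0 x = 0"
  by (simp add: nmul_def)

lemma nmul_Suc [simp]: "nmul (Suc n) x = x + nmul n x"
  by (simp add: nmul_def add.commute)

lemma nmul_add: "nmul (i + j) x = nmul i x + nmul j x"
  by (induction i) (auto simp: algebra_simps)

lemma nmul_diff_right: "nmul i (x - y) = nmul i x - nmul i y"
  by (induction i) (auto simp: algebra_simps)

lemma nmul_mono: "x \<le> y \<Longrightarrow> nmul i x \<le> nmul i (y::'g::linordered_ab_group_add)"
  by (induction i) (auto intro: add_mono)

lemma nmul_nonneg: "0 \<le> x \<Longrightarrow> 0 \<le> nmul i (x::'g::linordered_ab_group_add)"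
  by (induction i) auto

lemma nmul_ge_self: "0 \<le> x \<Longrightarrow> i \<noteq> 0 \<Longrightarrow> x \<le> nmul i (x::'g::linordered_ab_group_add)"
  by (cases i) (auto simp: nmul_nonneg)

lemma sum_Fin: "(\<Sum>i<n. Fin x) = Fin (nmul n (x::'g::linordered_ab_group_add))"
  by (induction n) (auto simp: zero_extended_def add.commute)

locale poly_valuation =
  fixes \<nu> :: "'k::field poly \<Rightarrow> 'g::linordered_ab_group_add extended"
  assumes val: "is_valuation \<nu>"
begin

lemma val_0 [simp]: "\<nu> 0 = Pinf"
  using val by (auto simp: is_valuation_def)

lemma val_1 [simp]: "\<nu> 1 = Fin 0"
  using val by (auto simp: is_valuation_def)

lemma val_ne_Minf [simp]: "\<nu> f \<noteq> Minf"
  using val by (auto simp: is_valuation_def)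

lemma val_mult: "\<nu> (f * g) = \<nu> f + \<nu> g"
  using val by (auto simp: is_valuation_def)

lemma val_min: "min (\<nu> f) (\<nu> g) \<le> \<nu> (f + g)"
  using val by (auto simp: is_valuation_def)

lemma val_add_ge: "c \<le> \<nu> f \<Longrightarrow> c \<le> \<nu> g \<Longrightarrow> c \<le> \<nu> (f + g)"
  using val_min[of f g] by (meson min.boundedI order_trans)

lemma val_add_gt: "c < \<nu> f \<Longrightarrow> c < \<nu> g \<Longrightarrow> c < \<nu> (f + g)"
  using val_min[of f g] by (meson min_less_iff_conj less_le_trans)

lemma val_minus_one: "\<nu> (- 1) = Fin 0"
proof -
  have "\<nu> (- 1) + \<nu> (- 1) = Fin 0"
    by (simp flip: val_mult)
  then show ?thesis
    by (cases "\<nu> (- 1)") auto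
qed

lemma val_minus [simp]: "\<nu> (- f) = \<nu> f"
proof -
  have "\<nu> (- f) = \<nu> (- 1) + \<nu> f" by (simp flip: val_mult)
  then show ?thesis by (cases "\<nu> f") (auto simp: val_minus_one)
qed

lemma val_diff_ge: "c \<le> \<nu> f \<Longrightarrow> c \<le> \<nu> g \<Longrightarrow> c \<le> \<nu> (f - g)"
  using val_add_ge[of c f "- g"] by simp

lemma val_diff_gt: "c < \<nu> f \<Longrightarrow> c < \<nu> g \<Longrightarrow> c < \<nu> (f - g)"
  using val_add_gt[of c f "- g"] by simp

lemma val_mult_ge: "Fin c \<le> \<nu> f \<Longrightarrow> Fin d \<le> \<nu> g \<Longrightarrow> Fin (c + d) \<le> \<nu> (f * g)"
  by (cases "\<nu> f"; cases "\<nu> g") (auto simp: val_mult add_mono)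

lemma val_mult_gt: "Fin c < \<nu> f \<Longrightarrow> Fin d \<le> \<nu> g \<Longrightarrow> Fin (c + d) < \<nu> (f * g)"
  by (cases "\<nu> f"; cases "\<nu> g") (auto simp: val_mult add_less_le_mono)

lemma val_add_eq:
  assumes "\<nu> f = Fin c" "Fin c < \<nu> g" shows "\<nu> (f + g) = Fin c"
proof -
  have "\<not> Fin c < \<nu> (f + g)"
    using val_diff_gt[of "Fin c" "f + g" g] assms by auto
  moreover have "Fin c \<le> \<nu> (f + g)"
    using val_add_ge[of "Fin c" f g] assms by simp
  ultimately show ?thesis by simp
qed

lemma val_sum_ge: "(\<And>i. i \<in> A \<Longrightarrow> c \<le> \<nu> (f i)) \<Longrightarrow> c \<le> \<nu> (sum f A)"
  by (induction A rule: infinite_finite_induct) (auto intro: val_add_ge)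

lemma val_sum_gt: "(\<And>i. i \<in> A \<Longrightarrow> Fin c < \<nu> (f i)) \<Longrightarrow> Fin c < \<nu> (sum f A)"
  by (induction A rule: infinite_finite_induct) (auto intro: val_add_gt)

lemma val_const_fin: assumes "a \<noteq> 0" obtains x where "\<nu> [:a:] = Fin x"
proof -
  have "\<nu> [:a:] + \<nu> [:inverse a:] = Fin 0"
    using assms by (simp flip: val_mult one_pCons)
  then show ?thesis using that by (cases "\<nu> [:a:]"; cases "\<nu> [:inverse a:]") auto
qed

lemma val_of_nat_nonneg: "Fin 0 \<le> \<nu> (of_nat n)"
  by (induction n) (auto intro: val_add_ge)

lemma val_power: "\<nu> f = Fin c \<Longrightarrow> \<nu> (f ^ n) = Fin (nmul n c)"
  by (induction n) (auto simp: val_mult)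

text \<open>The smallest of the distinct finite values is attained only once and is therefore the
  value of the sum. Used contrapositively: a vanishing sum of such terms has two summands of equal
  value.\<close>

lemma val_sum_distinct_ne_Pinf:
  assumes "finite A" "A \<noteq> {}" "\<And>i. i \<in> A \<Longrightarrow> \<nu> (f i) \<noteq> Pinf" "inj_on (\<lambda>i. \<nu> (f i)) A"
  shows "\<nu> (sum f A) \<noteq> Pinf"
proof -
  have "Min ((\<lambda>i. \<nu> (f i)) ` A) \<in> (\<lambda>i. \<nu> (f i)) ` A"
    using assms by (intro Min_in) auto
  then obtain k where k: "k \<in> A" "\<nu> (f k) = Min ((\<lambda>i. \<nu> (f i)) ` A)" by auto
  moreover have "\<nu> (f k) \<noteq> Pinf" "\<nu> (f k) \<noteq> Minf" using assms(3) k by auto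
  then obtain c where c: "\<nu> (f k) = Fin c" by (cases "\<nu> (f k)") blast+
  have "Fin c < \<nu> (f i)" if "i \<in> A - {k}" for i
  proof -
    have "\<nu> (f k) \<le> \<nu> (f i)" using k that assms(1) by auto
    moreover have "\<nu> (f k) \<noteq> \<nu> (f i)"
      using assms(4) k that by (auto dest: inj_onD)
    ultimately show ?thesis using c by auto
  qed
  then have "Fin c < \<nu> (sum f (A - {k}))" by (rule val_sum_gt)
  then have "\<nu> (f k + sum f (A - {k})) = Fin c" using c by (intro val_add_eq)
  then show ?thesis using assms(1) k by (simp add: sum.remove)
qed

end

subsection \<open>Weighted expansions\<close>

lemma degree_mod_less_pos: "0 < degree Q \<Longrightarrow> degree (f mod Q) < degree (Q :: 'k::field poly)"
  using degree_mod_less[of Q f] by (cases "Q = 0"; cases "f mod Q = 0") auto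

text \<open>Truncated subtraction makes the formula cover the zero quotient as well.\<close>

lemma degree_div_poly:
  assumes "0 < degree (Q :: 'k::field poly)" shows "degree (f div Q) = degree f - degree Q"
proof (cases "degree f < degree Q")
  case True
  then show ?thesis by (simp add: div_poly_less)
next
  case False
  then have nz: "f div Q \<noteq> 0" using assms by (auto simp: div_poly_eq_0_iff)
  have "degree (f mod Q) < degree (f div Q * Q)"
    using degree_mod_less_pos[OF assms, of f] nz assms by (subst degree_mult_eq) auto
  then have "degree (f div Q * Q + f mod Q) = degree (f div Q * Q)"
    by (rule degree_add_eq_left)
  also have "\<dots> = degree (f div Q) + degree Q" using nz assms by (subst degree_mult_eq) auto
  finally show ?thesis by simp
qed

lemma expc_0: "expc Q f 0 = f mod Q"
  by (simp add: expc_def)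

lemma expc_Suc: "expc Q f (Suc i) = expc Q (f div Q) i"
  by (simp add: expc_def poly_div_mult_right)

lemma expc_add: "expc Q (f + g) i = expc Q f i + expc Q g i"
  by (simp add: expc_def poly_div_add_left poly_mod_add_left)

lemma expc_zero [simp]: "expc Q 0 i = 0"
  by (simp add: expc_def)

lemma expc_sum: "expc Q (sum f A) i = (\<Sum>x\<in>A. expc Q (f x) i)"
  by (induction A rule: infinite_finite_induct) (auto simp: expc_add)

lemma expc_smult: "expc Q (smult c f) i = smult c (expc Q f i)"
  by (simp add: expc_def div_smult_left mod_smult_left)

lemma expc_small: "degree f < degree Q \<Longrightarrow> expc Q f i = (if i = 0 then f else 0)"
  by (cases i) (auto simp: expc_0 expc_Suc mod_poly_less div_poly_less)

lemma expc_mult_power: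
  assumes "Q \<noteq> 0"
  shows "expc Q (f * Q ^ k) i = (if k \<le> i then expc Q f (i - k) else 0)"
proof (induction k arbitrary: i)
  case (Suc k)
  have eq: "f * Q ^ Suc k = Q * (f * Q ^ k)" by (simp add: ac_simps)
  show ?case
  proof (cases i)
    case 0
    then show ?thesis unfolding eq by (simp add: expc_0)
  next
    case (Suc j)
    then show ?thesis unfolding eq using Suc.IH[of j] assms by (simp add: expc_Suc)
  qed
qed simp

lemma degree_expc: "degree Q > 0 \<Longrightarrow> degree (expc Q f i) < degree Q"
  unfolding expc_def by (rule degree_mod_less_pos)

lemma expc_eq_0:
  assumes "degree Q > 0" "degree f < i * degree Q"
  shows "expc Q f i = 0"
proof -
  have "degree f < degree (Q ^ i)" using assms by (subst degree_power_eq) auto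
  then show ?thesis by (simp add: expc_def div_poly_less)
qed

text \<open>Induction on the number of digits of the \<open>Q\<close>-expansion: a step removes the
  lowest digit.\<close>

lemma expansion_induct [consumes 1, case_names small step]:
  assumes "0 < degree (Q :: 'k::field poly)"
    and "\<And>g. degree g < degree Q \<Longrightarrow> T g"
    and "\<And>g. degree g \<ge> degree Q \<Longrightarrow> T (g div Q) \<Longrightarrow> T g"
  shows "T g"
proof (induction "degree g" arbitrary: g rule: less_induct)
  case less
  show ?case
  proof (cases "degree g < degree Q")
    case False
    then have "degree (g div Q) < degree g"
      using assms(1) by (simp add: degree_div_poly)
    then show ?thesis using less False assms(3) by auto
  qed (rule assms(2))
qed

lemma expansion_sum:
  assumes "0 < degree Q"
  shows "degree f < (Suc n) * degree Q \<Longrightarrow> f = (\<Sum>i\<le>n. expc Q f i * Q ^ i)"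
proof (induction n arbitrary: f)
  case 0
  then show ?case by (simp add: expc_small)
next
  case (Suc n)
  have "degree (f div Q) < Suc n * degree Q"
    using Suc.prems assms by (auto simp: degree_div_poly)
  then have "f div Q = (\<Sum>i\<le>n. expc Q (f div Q) i * Q ^ i)" by (rule Suc.IH)
  then have "f = f mod Q + (\<Sum>i\<le>n. expc Q (f div Q) i * Q ^ i) * Q"
    by (metis mod_div_mult_eq)
  also have "\<dots> = (\<Sum>i\<le>Suc n. expc Q f i * Q ^ i)"
    by (simp only: sum.atMost_Suc_shift expc_0 expc_Suc) (simp add: sum_distrib_left ac_simps)
  finally show ?case .
qed

lemma expansion_sum_degree:
  assumes "0 < degree Q" shows "f = (\<Sum>i\<le>degree f. expc Q f i * Q ^ i)"
proof -
  have "degree f < Suc (degree f) * 1" by simp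
  also have "\<dots> \<le> Suc (degree f) * degree Q" using assms by (intro mult_left_mono) auto
  finally show ?thesis by (rule expansion_sum[OF assms])
qed

text \<open>The weight \<open>\<gamma>\<close> of \<open>Q\<close> may be smaller than \<open>\<nu> Q\<close>: carries in \<open>Q\<close>-expansions are bounded using the
  value of an earlier key polynomial, and the difference to \<open>\<nu> Q\<close> is then the gain of each carry.\<close>

definition weight_ge ::
  "('k::field poly \<Rightarrow> 'g::linordered_ab_group_add extended) \<Rightarrow> 'k poly \<Rightarrow> 'g \<Rightarrow> 'g \<Rightarrow> 'k poly \<Rightarrow> bool" where
  "weight_ge \<nu> Q \<gamma> c f \<longleftrightarrow> (\<forall>i. Fin (c - nmul i \<gamma>) \<le> \<nu> (expc Q f i))"

text \<open>The digits of \<open>f div Q\<close> are those of \<open>f\<close> moved down one place,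
  so one weight \<open>\<gamma>\<close> is subtracted from the bound. This is the form suited to
  \<open>expansion_induct\<close>.\<close>

lemma weight_ge_rec:
  "weight_ge \<nu> Q \<gamma> c f \<longleftrightarrow> Fin c \<le> \<nu> (f mod Q) \<and> weight_ge \<nu> Q \<gamma> (c - \<gamma>) (f div Q)"
proof -
  have "weight_ge \<nu> Q \<gamma> c f \<longleftrightarrow> (\<forall>i. case i of 0 \<Rightarrow> Fin c \<le> \<nu> (f mod Q)
     | Suc j \<Rightarrow> Fin (c - \<gamma> - nmul j \<gamma>) \<le> \<nu> (expc Q (f div Q) j))"
    unfolding weight_ge_def
    by (intro all_cong1) (auto simp: expc_0 expc_Suc algebra_simps split: nat.splits)
  also have "\<dots> \<longleftrightarrow> Fin c \<le> \<nu> (f mod Q) \<and> weight_ge \<nu> Q \<gamma> (c - \<gamma>) (f div Q)"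
    unfolding weight_ge_def by (auto split: nat.splits)
  finally show ?thesis .
qed

lemma weight_ge_mono: "weight_ge \<nu> Q \<gamma> c f \<Longrightarrow> d \<le> c \<Longrightarrow> weight_ge \<nu> Q \<gamma> d f"
  unfolding weight_ge_def
  by (meson diff_right_mono less_eq_extended.simps(1) order_trans)

lemma weight_ge_mono2:
  assumes "weight_ge \<nu> Q \<gamma> c f" "\<gamma> \<le> \<gamma>'" shows "weight_ge \<nu> Q \<gamma>' c f"
  unfolding weight_ge_def
proof
  fix i
  have "Fin (c - nmul i \<gamma>') \<le> Fin (c - nmul i \<gamma>)" using nmul_mono[OF assms(2)] by simp
  also have "\<dots> \<le> \<nu> (expc Q f i)" using assms(1) by (auto simp: weight_ge_def)
  finally show "Fin (c - nmul i \<gamma>') \<le> \<nu> (expc Q f i)" .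
qed

context poly_valuation begin

lemma weight_ge_add:
  "weight_ge \<nu> Q \<gamma> c f \<Longrightarrow> weight_ge \<nu> Q \<gamma> c g \<Longrightarrow> weight_ge \<nu> Q \<gamma> c (f + g)"
  by (auto simp: weight_ge_def expc_add intro: val_add_ge)

lemma weight_ge_0 [simp]: "weight_ge \<nu> Q \<gamma> c 0"
  by (simp add: weight_ge_def)

lemma weight_ge_small: "degree f < degree Q \<Longrightarrow> Fin c \<le> \<nu> f \<Longrightarrow> weight_ge \<nu> Q \<gamma> c f"
  by (simp add: weight_ge_def expc_small)

lemma weight_ge_mult_self:
  assumes "Q \<noteq> 0" "weight_ge \<nu> Q \<gamma> c f" shows "weight_ge \<nu> Q \<gamma> (c + \<gamma>) (Q * f)"
  using assms by (subst weight_ge_rec) simp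

lemma weight_ge_imp_val_ge:
  assumes "0 < degree Q" "Fin \<gamma> \<le> \<nu> Q"
  shows "weight_ge \<nu> Q \<gamma> c f \<Longrightarrow> Fin c \<le> \<nu> f"
  using assms(1)
proof (induction f arbitrary: c rule: expansion_induct)
  case (small f)
  then show ?case unfolding weight_ge_rec[of \<nu> Q \<gamma> c f] by (simp add: mod_poly_less)
next
  case (step f)
  have "Fin c \<le> \<nu> (f mod Q)" "weight_ge \<nu> Q \<gamma> (c - \<gamma>) (f div Q)"
    using step.prems unfolding weight_ge_rec[of \<nu> Q \<gamma> c f] by auto
  then have "Fin c \<le> \<nu> (f mod Q + Q * (f div Q))"
    using val_mult_ge[OF assms(2) step.IH[of "c - \<gamma>"]] by (intro val_add_ge) auto
  then show ?case by simp
qed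

end

section \<open>Carries in products of expansions\<close>

locale carry_bound = poly_valuation \<nu>
  for \<nu> :: "'k::field poly \<Rightarrow> 'g::linordered_ab_group_add extended" +
  fixes Q :: "'k poly" and \<gamma> :: 'g
  assumes degree_pos: "0 < degree Q"
    and weight_le: "Fin \<gamma> \<le> \<nu> Q"
    and carry: "\<And>f g a b. degree f < degree Q \<Longrightarrow> degree g < degree Q \<Longrightarrow>
       Fin a \<le> \<nu> f \<Longrightarrow> Fin b \<le> \<nu> g \<Longrightarrow> Fin (a + b - \<gamma>) \<le> \<nu> ((f * g) div Q)"
begin

lemma degree_carry:
  assumes "degree f < degree Q" "degree g < degree Q"
  shows "degree ((f * g) div Q) < degree Q"
  using assms degree_mult_le[of f g] degree_pos by (simp add: degree_div_poly)

text \<open>A product of two digits has at most two digits. The quotient is bounded by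
  \<open>carry\<close>; the remainder is \<open>f * g\<close> minus \<open>Q\<close> times the
  quotient, and both of these have value at least \<open>a + b\<close>.\<close>

lemma weight_ge_small_mult_small:
  assumes "degree f < degree Q" "Fin a \<le> \<nu> f" "degree g < degree Q" "Fin b \<le> \<nu> g"
  shows "weight_ge \<nu> Q \<gamma> (a + b) (f * g)"
proof -
  have c: "Fin (a + b - \<gamma>) \<le> \<nu> ((f * g) div Q)" using carry assms by auto
  have "Fin (a + b) \<le> \<nu> (f * g - Q * ((f * g) div Q))"
    using val_mult_ge[OF weight_le c] val_mult_ge[OF assms(2,4)] by (intro val_diff_ge) auto
  then have "Fin (a + b) \<le> \<nu> ((f * g) mod Q)"
    by (simp add: minus_mult_div_eq_mod)
  then show ?thesis
    using c assms degree_carry by (subst weight_ge_rec) (auto intro: weight_ge_small)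
qed

lemma weight_ge_mult_small:
  assumes "degree f < degree Q" "Fin a \<le> \<nu> f"
  shows "weight_ge \<nu> Q \<gamma> c g \<Longrightarrow> weight_ge \<nu> Q \<gamma> (a + c) (f * g)"
  using degree_pos
proof (induction g arbitrary: c rule: expansion_induct)
  case (small g)
  then have "Fin c \<le> \<nu> g" unfolding weight_ge_rec[of \<nu> Q \<gamma> c g] by (simp add: mod_poly_less)
  then show ?case using small assms by (intro weight_ge_small_mult_small)
next
  case (step g)
  have c: "Fin c \<le> \<nu> (g mod Q)" "weight_ge \<nu> Q \<gamma> (c - \<gamma>) (g div Q)"
    using step.prems unfolding weight_ge_rec[of \<nu> Q \<gamma> c g] by auto
  have "degree (g mod Q) < degree Q"
    using degree_pos by (rule degree_mod_less_pos)
  then have "weight_ge \<nu> Q \<gamma> (a + c) (f * (g mod Q))"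
    using assms c by (intro weight_ge_small_mult_small)
  moreover have "weight_ge \<nu> Q \<gamma> (a + (c - \<gamma>) + \<gamma>) (Q * (f * (g div Q)))"
    using degree_pos step.IH[OF c(2)] by (intro weight_ge_mult_self) auto
  ultimately have "weight_ge \<nu> Q \<gamma> (a + c) (f * (g mod Q) + Q * (f * (g div Q)))"
    by (intro weight_ge_add) (auto simp: algebra_simps)
  also have "f * (g mod Q) + Q * (f * (g div Q)) = f * (g mod Q + Q * (g div Q))"
    by (simp only: algebra_simps)
  finally show ?case by simp
qed

lemma weight_ge_mult_power_small:
  assumes "degree f < degree Q" "Fin a \<le> \<nu> f" "weight_ge \<nu> Q \<gamma> c g"
  shows "weight_ge \<nu> Q \<gamma> (c + nmul n a) (g * f ^ n)"
proof (induction n)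
  case (Suc n)
  have "weight_ge \<nu> Q \<gamma> (a + (c + nmul n a)) (f * (g * f ^ n))"
    using assms(1,2) Suc by (rule weight_ge_mult_small)
  then show ?case by (simp add: ac_simps)
qed (use assms in simp)

text \<open>Write \<open>R = Q + (R - Q)\<close> in the \<open>R\<close>-expansion. As
  \<open>R - Q\<close> is a digit of value at least \<open>\<gamma>\<close>, multiplication by it
  raises the bound by \<open>\<gamma>\<close>, just as multiplication by \<open>Q\<close>
  does.\<close>

lemma weight_ge_change:
  assumes "degree R = degree Q" "degree (R - Q) < degree Q" "Fin \<gamma> \<le> \<nu> (R - Q)"
  shows "weight_ge \<nu> R \<gamma> c g \<Longrightarrow> weight_ge \<nu> Q \<gamma> c g"
proof -
  have "0 < degree R" using degree_pos assms by simp
  then show "weight_ge \<nu> R \<gamma> c g \<Longrightarrow> weight_ge \<nu> Q \<gamma> c g"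
  proof (induction g arbitrary: c rule: expansion_induct)
    case (small g)
    then have "Fin c \<le> \<nu> g" unfolding weight_ge_rec[of \<nu> R \<gamma> c g] by (simp add: mod_poly_less)
    then show ?case using small assms by (intro weight_ge_small) auto
  next
    case (step g)
    have c: "Fin c \<le> \<nu> (g mod R)" "weight_ge \<nu> R \<gamma> (c - \<gamma>) (g div R)"
      using step.prems unfolding weight_ge_rec[of \<nu> R \<gamma> c g] by auto
    have d: "degree (g mod R) < degree Q"
      using degree_pos assms degree_mod_less_pos[of R g] by auto
    have IH: "weight_ge \<nu> Q \<gamma> (c - \<gamma>) (g div R)"
      by (rule step.IH[OF c(2)])
    have "weight_ge \<nu> Q \<gamma> (\<gamma> + (c - \<gamma>)) ((R - Q) * (g div R))"
      using assms IH by (intro weight_ge_mult_small)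
    moreover have "weight_ge \<nu> Q \<gamma> (c - \<gamma> + \<gamma>) (Q * (g div R))"
      using degree_pos IH by (intro weight_ge_mult_self) auto
    ultimately have "weight_ge \<nu> Q \<gamma> c (g mod R + ((R - Q) * (g div R) + Q * (g div R)))"
      using weight_ge_small[OF d c(1)] by (intro weight_ge_add) auto
    also have "g mod R + ((R - Q) * (g div R) + Q * (g div R)) = g mod R + R * (g div R)"
      by (simp only: algebra_simps)
    finally show ?case by simp
  qed
qed

end

subsection \<open>Key polynomials\<close>

text \<open>Translates the level at \<open>s = 1\<close> into ordinary derivatives, to which the
  product rule applies.\<close>

lemma hasse_1: "hasse 1 f = pderiv f"
proof (induction f)
  case 0
  then show ?case by (simp add: hasse_def)
next
  case (pCons a f)
  have *: "hasse 0 f = f" for f :: "'a poly"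
  proof (induction f)
    case 0
    then show ?case by (simp add: hasse_def)
  next
    case (pCons a f)
    then show ?case by (simp add: hasse_def map_poly_pCons pcompose_pCons coeff_mult mult_pCons_left)
  qed
  have "hasse 1 (pCons a f) = [:0, 1:] * hasse 1 f + hasse 0 f"
    by (simp add: hasse_def map_poly_pCons pcompose_pCons mult_pCons_left coeff_pCons)
  then show ?case using pCons.IH by (simp add: * pderiv_pCons)
qed

lemma monic_diff_degree:
  assumes "degree P = degree Q" "lead_coeff P = 1" "lead_coeff Q = 1" "0 < degree (Q :: 'k::field poly)"
  shows "degree (P - Q) < degree Q"
proof (rule ccontr)
  assume "\<not> ?thesis"
  moreover have "degree (P - Q) \<le> degree Q" using assms by (intro degree_diff_le) auto
  ultimately have eq: "degree (P - Q) = degree Q" by simp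
  have "coeff (P - Q) (degree Q) = 0" using assms by simp
  then have "P - Q = 0" using eq by (metis leading_coeff_0_iff)
  then show False using eq assms(4) by simp
qed

lemma gdiv_1: "gdiv x 1 = x"
  by (simp add: gdiv_def)

text \<open>The consequences of \<open>I(Q) = {1}\<close> for a key polynomial of finite value that are needed:
  \<open>\<gamma> - d\<close> is the level of \<open>Q\<close>.\<close>

definition simple_key ::
  "('k::field poly \<Rightarrow> 'g::linordered_ab_group_add extended) \<Rightarrow> 'k poly \<Rightarrow> 'g \<Rightarrow> 'g \<Rightarrow> bool" where
  "simple_key \<nu> Q \<gamma> d \<longleftrightarrow> 0 < degree Q \<and> lead_coeff Q = 1 \<and> \<nu> Q = Fin \<gamma> \<and> \<nu> (pderiv Q) = Fin d \<and>
     (\<forall>f. f \<noteq> 0 \<longrightarrow> degree f < degree Q \<longrightarrow> (\<exists>a. \<nu> f = Fin a \<and> Fin (a + d - \<gamma>) < \<nu> (pderiv f)))"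

context poly_valuation begin

text \<open>The maximum defining \<open>eps \<nu> Q\<close> is attained at \<open>s = 1\<close>,
  hence equals \<open>\<gamma> - d\<close>. For \<open>f\<close> of smaller degree only the term
  \<open>s = 1\<close> of its level is compared with this.\<close>

lemma keypoly_imp_simple_key:
  assumes "keypoly \<nu> Q" "0 < degree Q" "\<nu> Q \<noteq> Pinf" "Ilev \<nu> Q = {1}"
  obtains \<gamma> d where "simple_key \<nu> Q \<gamma> d"
proof -
  obtain \<gamma> where \<gamma>: "\<nu> Q = Fin \<gamma>" using assms(3) by (cases "\<nu> Q") auto
  have I: "\<nu> (hasse 1 Q) \<noteq> Pinf" "lvl \<nu> Q 1 = eps \<nu> Q" using assms(4) by (auto simp: Ilev_def)
  then obtain d where d: "\<nu> (pderiv Q) = Fin d"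
    by (cases "\<nu> (pderiv Q)") (auto simp only: hasse_1 val_ne_Minf)
  have eps: "eps \<nu> Q = Fin (\<gamma> - d)"
    using I \<gamma> d by (simp add: lvl_def hasse_1[unfolded One_nat_def] gdiv_1[unfolded One_nat_def])
  have "\<exists>a. \<nu> f = Fin a \<and> Fin (a + d - \<gamma>) < \<nu> (pderiv f)" if f: "f \<noteq> 0" "degree f < degree Q" for f
  proof (cases "degree f = 0")
    case True
    then obtain c where c: "f = [:c:]" by (auto elim: degree_eq_zeroE)
    then obtain x where "\<nu> f = Fin x" using val_const_fin[of c] f by auto
    then show ?thesis using c by simp
  next
    case False
    have less: "eps \<nu> f < Fin (\<gamma> - d)" using assms(1) f eps by (auto simp: keypoly_def)
    \<comment> \<open>An infinite value would make the level of \<open>f\<close> infinite, against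
      the key polynomial property.\<close>
    have "\<nu> f \<noteq> Pinf" using less False by (auto simp: eps_def)
    then obtain a where a: "\<nu> f = Fin a" by (cases "\<nu> f") auto
    have "lvl \<nu> f 1 \<le> eps \<nu> f" using False a by (auto simp: eps_def)
    with less have *: "lvl \<nu> f 1 < Fin (\<gamma> - d)" by simp
    have "Fin (a + d - \<gamma>) < \<nu> (pderiv f)"
    proof (cases "\<nu> (pderiv f)")
      case (Fin b)
      then have "a - b < \<gamma> - d"
        using * a by (simp add: lvl_def hasse_1[unfolded One_nat_def] gdiv_1[unfolded One_nat_def])
      then show ?thesis using Fin by (simp add: algebra_simps)
    qed auto
    then show ?thesis using a by auto
  qed
  then show ?thesis
    using that[of \<gamma> d] \<gamma> d assms by (auto simp: simple_key_def keypoly_def)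
qed

lemma simple_key_pderiv_gt:
  assumes "simple_key \<nu> Q \<gamma> d" "degree f < degree Q" "Fin a \<le> \<nu> f"
  shows "Fin (a + d - \<gamma>) < \<nu> (pderiv f)"
proof (cases "f = 0")
  case False
  then obtain b where b: "\<nu> f = Fin b" "Fin (b + d - \<gamma>) < \<nu> (pderiv f)"
    using assms by (auto simp: simple_key_def)
  have "Fin (a + d - \<gamma>) \<le> Fin (b + d - \<gamma>)" using assms(3) b by simp
  then show ?thesis using b(2) by (rule le_less_trans)
qed simp

text \<open>Differentiate \<open>f g = q Q + r\<close> once: if \<open>q Q\<close> had value at most that of \<open>f g\<close>, the term
  \<open>q Q'\<close> would have strictly smaller value than all others.\<close>

lemma simple_key_carry_gt:
  assumes key: "simple_key \<nu> Q \<gamma> d" and f: "degree f < degree Q" "Fin a \<le> \<nu> f"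
    and g: "degree g < degree Q" "Fin b \<le> \<nu> g"
  shows "Fin (a + b - \<gamma>) < \<nu> ((f * g) div Q)"
proof (rule ccontr)
  define q r where "q = (f * g) div Q" and "r = (f * g) mod Q"
  assume "\<not> ?thesis"
  then have le: "\<nu> q \<le> Fin (a + b - \<gamma>)" by (simp add: q_def)
  then obtain s where s: "\<nu> q = Fin s" by (cases "\<nu> q") auto
  with le have s_le: "s + \<gamma> \<le> a + b" by (simp add: algebra_simps)
  have Q: "\<nu> Q = Fin \<gamma>" "\<nu> (pderiv Q) = Fin d" "0 < degree Q" using key by (auto simp: simple_key_def)
  have r: "degree r < degree Q" unfolding r_def using Q(3) by (rule degree_mod_less_pos)
  have q: "degree q < degree Q"
    unfolding q_def using f g Q degree_mult_le[of f g] by (simp add: degree_div_poly)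
  have eq: "f * g = q * Q + r" by (simp add: q_def r_def)
  have ab: "Fin (s + \<gamma>) \<le> \<nu> (f * g)"
    using val_mult_ge[OF f(2) g(2)] s_le by (meson less_eq_extended.simps(1) order_trans)
  then have "Fin (s + \<gamma>) \<le> \<nu> (f * g - q * Q)"
    using s Q by (intro val_diff_ge) (auto simp: val_mult)
  then have "Fin (s + \<gamma>) \<le> \<nu> r" by (simp add: eq)
  then have dr: "Fin (s + d) < \<nu> (pderiv r)" using simple_key_pderiv_gt[OF key r, of "s + \<gamma>"] by simp
  have "Fin (a + b + d - \<gamma>) < \<nu> (f * pderiv g + g * pderiv f)"
    using val_mult_gt[OF simple_key_pderiv_gt[OF key g] f(2)]
      val_mult_gt[OF simple_key_pderiv_gt[OF key f] g(2)]
    by (intro val_add_gt) (auto simp: algebra_simps)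
  moreover have "Fin (s + d) \<le> Fin (a + b + d - \<gamma>)" using s_le by (simp add: algebra_simps)
  ultimately have "Fin (s + d) < \<nu> (pderiv (f * g))"
    unfolding pderiv_mult by (rule le_less_trans[rotated])
  then have "Fin (s + d) < \<nu> (pderiv (f * g) - pderiv r)" using dr by (rule val_diff_gt)
  then have gt: "Fin (s + d) < \<nu> (pderiv (q * Q))" by (simp add: eq pderiv_add)
  have "\<nu> (q * pderiv Q) = Fin (s + d)" using s Q by (simp add: val_mult)
  moreover have "Fin (s + d) < \<nu> (Q * pderiv q)"
    using val_mult_gt[OF simple_key_pderiv_gt[OF key q, of s], of \<gamma> Q] s Q by (simp add: ac_simps)
  ultimately have "\<nu> (pderiv (q * Q)) = Fin (s + d)"
    unfolding pderiv_mult by (rule val_add_eq)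
  with gt show False by simp
qed

text \<open>The carry times \<open>Q\<close> has value above \<open>a + b\<close>, so subtracting it
  does not change the value of the product.\<close>

lemma simple_key_mod:
  assumes key: "simple_key \<nu> Q \<gamma> d" and f: "degree f < degree Q" "\<nu> f = Fin a"
    and g: "degree g < degree Q" "\<nu> g = Fin b"
  shows "\<nu> ((f * g) mod Q) = Fin (a + b)"
proof -
  have "Fin (a + b - \<gamma> + \<gamma>) < \<nu> ((f * g) div Q * Q)"
    using simple_key_carry_gt[OF key f(1) _ g(1), of a b] f g key
    by (intro val_mult_gt) (auto simp: simple_key_def)
  then have "\<nu> (f * g + - ((f * g) div Q * Q)) = Fin (a + b)"
    using f g by (intro val_add_eq) (auto simp: val_mult)
  then show ?thesis by (simp add: minus_div_mult_eq_mod)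
qed

lemma simple_key_mod_mult_power:
  assumes key: "simple_key \<nu> Q \<gamma> d" and f: "degree f < degree Q" "\<nu> f = Fin a"
    and h: "degree h < degree Q" "\<nu> h = Fin b"
  shows "\<nu> ((f * h ^ n) mod Q) = Fin (a + nmul n b)"
proof (induction n)
  case 0
  then show ?case using f by (simp add: mod_poly_less)
next
  case (Suc n)
  have "0 < degree Q" using key by (simp add: simple_key_def)
  then have "\<nu> ((h * ((f * h ^ n) mod Q)) mod Q) = Fin (b + (a + nmul n b))"
    using simple_key_mod[OF key h degree_mod_less_pos Suc] by simp
  then show ?case by (simp add: mod_mult_right_eq ac_simps)
qed

text \<open>Divide by \<open>Q0\<close> first and write \<open>Q0 = Q - h\<close>. The quotient by
  \<open>Q\<close> is then \<open>e\<close> minus the carry of \<open>e * h\<close>, a product of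
  smaller total degree, so induction applies. The bound involves \<open>\<gamma>0\<close> only and
  thus holds uniformly for all later \<open>Q\<close>.\<close>

lemma simple_key_carry_bound:
  assumes key0: "simple_key \<nu> Q0 \<gamma>0 d0" and key: "simple_key \<nu> Q \<gamma> d"
    and deg: "degree Q = degree Q0" and le: "\<gamma>0 \<le> \<gamma>"
  shows "carry_bound \<nu> Q \<gamma>0"
proof
  define h where "h = Q - Q0"
  have deg0: "0 < degree Q0" using key0 by (simp add: simple_key_def)
  have h: "degree h < degree Q0"
    unfolding h_def using key0 key deg by (intro monic_diff_degree) (auto simp: simple_key_def)
  have h': "Fin \<gamma>0 \<le> \<nu> h"
    unfolding h_def using key0 key le by (intro val_diff_ge) (auto simp: simple_key_def)
  show "Fin (a + b - \<gamma>0) \<le> \<nu> ((f * g) div Q)"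
    if "degree f < degree Q" "degree g < degree Q" "Fin a \<le> \<nu> f" "Fin b \<le> \<nu> g" for f g a b
    using that
  proof (induction "degree f + degree g" arbitrary: f g a b rule: less_induct)
    case less
    define e r where "e = (f * g) div Q0" and "r = (f * g) mod Q0"
    have e: "degree e = degree (f * g) - degree Q0" using deg0 by (simp add: e_def degree_div_poly)
    have r: "degree r < degree Q" using deg0 by (simp add: r_def deg degree_mod_less_pos)
    have ge: "Fin (a + b - \<gamma>0) \<le> \<nu> e"
      unfolding e_def using simple_key_carry_gt[OF key0, of f a g b] less.prems deg by auto
    have eq: "f * g = e * Q + (r - e * h)" by (simp add: e_def r_def h_def algebra_simps)
    have "(f * g) div Q = e - (e * h) div Q"
      unfolding eq using key deg0 deg r
      by (auto simp: poly_div_add_left poly_div_diff_left div_poly_less)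
    moreover have "Fin (a + b - \<gamma>0) \<le> \<nu> ((e * h) div Q)"
    proof (cases "degree (f * g) < degree Q0")
      case True
      then have "e = 0" by (simp add: e_def div_poly_less)
      then show ?thesis by simp
    next
      case False
      \<comment> \<open>The degree lost in dividing by \<open>Q0\<close> exceeds the degree of
        \<open>h\<close>.\<close>
      then have "degree e + degree h < degree f + degree g" "degree e < degree Q"
        using e h degree_mult_le[of f g] less.prems deg by auto
      then show ?thesis
        using less.hyps[of e h "a + b - \<gamma>0" \<gamma>0] ge h h' deg by simp
    qed
    ultimately show ?case using ge by (auto intro: val_diff_ge)
  qed
  show "0 < degree Q" "Fin \<gamma>0 \<le> \<nu> Q" using key le by (auto simp: simple_key_def)
qed

end

text \<open>Elimination of the coefficient of degree \<open>n\<close> against one polynomial in which it does not vanish.\<close>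

lemma poly_linear_dependent:
  fixes g :: "nat \<Rightarrow> 'k::field poly"
  assumes "\<And>i. i \<in> A \<Longrightarrow> \<forall>k\<ge>n. coeff (g i) k = 0" "finite A" "n < card A"
  shows "\<exists>a. (\<exists>i\<in>A. a i \<noteq> 0) \<and> (\<Sum>i\<in>A. smult (a i) (g i)) = 0"
  using assms
proof (induction n arbitrary: A g)
  case 0
  then have "g i = 0" if "i \<in> A" for i using that by (auto simp: poly_eq_iff)
  moreover obtain i where "i \<in> A" using 0 by fastforce
  ultimately show ?case by (intro exI[of _ "\<lambda>_. 1"]) auto
next
  case (Suc n)
  show ?case
  proof (cases "\<forall>i\<in>A. coeff (g i) n = 0")
    case True
    have "\<forall>k\<ge>n. coeff (g i) k = 0" if "i \<in> A" for i
      using Suc.prems(1)[OF that] True that by (metis le_eq_less_or_eq Suc_leI)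
    then show ?thesis using Suc.prems by (intro Suc.IH) auto
  next
    case False
    then obtain p where p: "p \<in> A" "coeff (g p) n \<noteq> 0" by auto
    define c where "c i = coeff (g i) n / coeff (g p) n" for i
    define g' where "g' i = g i - smult (c i) (g p)" for i
    have "\<forall>k\<ge>n. coeff (g' i) k = 0" if "i \<in> A - {p}" for i
    proof (intro allI impI)
      fix k assume "n \<le> k"
      then consider "k = n" | "k \<ge> Suc n" by linarith
      then show "coeff (g' i) k = 0"
        using p that Suc.prems(1)[of i] Suc.prems(1)[of p] by cases (auto simp: g'_def c_def)
    qed
    moreover have "finite (A - {p})" "n < card (A - {p})" using Suc.prems p by auto
    ultimately obtain a where a: "\<exists>i\<in>A - {p}. a i \<noteq> 0" "(\<Sum>i\<in>A - {p}. smult (a i) (g' i)) = 0"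
      using Suc.IH[of "A - {p}" g'] by blast
    define b where "b = a(p := - (\<Sum>i\<in>A - {p}. a i * c i))"
    have "(\<Sum>i\<in>A. smult (b i) (g i)) = smult (b p) (g p) + (\<Sum>i\<in>A - {p}. smult (b i) (g i))"
      using p Suc.prems by (simp add: sum.remove)
    also have "(\<Sum>i\<in>A - {p}. smult (b i) (g i)) = (\<Sum>i\<in>A - {p}. smult (a i) (g' i) + smult (a i * c i) (g p))"
      by (intro sum.cong) (auto simp: b_def g'_def smult_diff_right)
    also have "\<dots> = smult (\<Sum>i\<in>A - {p}. a i * c i) (g p)"
      by (simp add: sum.distrib a smult_sum)
    finally have "(\<Sum>i\<in>A. smult (b i) (g i)) = 0" by (simp add: b_def)
    moreover have "\<exists>i\<in>A. b i \<noteq> 0" using a(1) by (auto simp: b_def)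
    ultimately show ?thesis by blast
  qed
qed

section \<open>Values of polynomials of small degree\<close>

context poly_valuation begin

text \<open>The \<open>degree Q + 1\<close> reduced powers of \<open>f\<close> live in a vector
  space of dimension \<open>degree Q\<close>, hence are linearly dependent. Two terms of the
  relation have equal value, so a positive multiple of \<open>c\<close> is the value of a
  constant.\<close>

lemma simple_key_small_val_in_Gamma:
  assumes key: "simple_key \<nu> Q \<gamma> d" and f: "degree f < degree Q" "\<nu> f = Fin c"
  shows "c \<in> Gamma \<nu>"
proof -
  define g where "g i = f ^ i mod Q" for i
  have deg: "0 < degree Q" using key by (simp add: simple_key_def)
  have g: "\<nu> (g i) = Fin (nmul i c)" for i
    using simple_key_mod_mult_power[OF key _ _ f, of 1 0 i] deg by (simp add: g_def)
  have "\<forall>k\<ge>degree Q. coeff (g i) k = 0" for i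
    using degree_mod_less_pos[OF deg, of "f ^ i"] by (auto simp: g_def intro!: coeff_eq_0)
  then obtain a where a: "\<exists>i\<in>{..degree Q}. a i \<noteq> 0" "(\<Sum>i\<in>{..degree Q}. smult (a i) (g i)) = 0"
    using poly_linear_dependent[of "{..degree Q}" "degree Q" g] by auto
  \<comment> \<open>Terms with zero coefficient are dropped, so that all remaining terms have finite
    value.\<close>
  define A where "A = {i\<in>{..degree Q}. a i \<noteq> 0}"
  have A: "finite A" "A \<noteq> {}" using a by (auto simp: A_def)
  have "(\<Sum>i\<in>A. smult (a i) (g i)) = 0"
    unfolding a(2)[symmetric] by (intro sum.mono_neutral_left) (auto simp: A_def)
  then have sum: "\<nu> (\<Sum>i\<in>A. smult (a i) (g i)) = Pinf" by simp
  have v: "\<exists>x. \<nu> [:a i:] = Fin x \<and> \<nu> (smult (a i) (g i)) = Fin (x + nmul i c)" if "i \<in> A" for i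
  proof -
    have "a i \<noteq> 0" using that by (simp add: A_def)
    then obtain x where "\<nu> [:a i:] = Fin x" by (rule val_const_fin)
    then show ?thesis using val_mult[of "[:a i:]" "g i"] g by simp
  qed
  have "\<not> inj_on (\<lambda>i. \<nu> (smult (a i) (g i))) A"
    using val_sum_distinct_ne_Pinf[OF A, of "\<lambda>i. smult (a i) (g i)"] v sum by fastforce
  then obtain i j where ij: "i \<in> A" "j \<in> A" "i \<noteq> j" "\<nu> (smult (a i) (g i)) = \<nu> (smult (a j) (g j))"
    by (auto simp: inj_on_def)
  have "\<exists>i j. i \<in> A \<and> j \<in> A \<and> i < j \<and> \<nu> (smult (a i) (g i)) = \<nu> (smult (a j) (g j))"
    using ij by (metis linorder_neqE_nat)
  then obtain i j where ij: "i \<in> A" "j \<in> A" "i < j" "\<nu> (smult (a i) (g i)) = \<nu> (smult (a j) (g j))"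
    by auto
  obtain x y where xy: "\<nu> [:a i:] = Fin x" "\<nu> [:a j:] = Fin y" "x + nmul i c = y + nmul j c"
    using v[OF ij(1)] v[OF ij(2)] ij(4) by auto
  have nz: "a i \<noteq> 0" "a j \<noteq> 0" using ij by (auto simp: A_def)
  have "nmul j c = nmul (j - i) c + nmul i c" using nmul_add[of "j - i" i c] ij by simp
  then have *: "x = y + nmul (j - i) c" using xy(3) by (simp add: algebra_simps)
  have "[:a j:] * [:a i / a j:] = [:a i:]" using nz by simp
  then have "Fin y + \<nu> [:a i / a j:] = Fin x" using xy by (metis val_mult)
  then have "\<nu> [:a i / a j:] = Fin (nmul (j - i) c)"
    using * by (cases "\<nu> [:a i / a j:]") auto
  then show ?thesis using nz ij unfolding Gamma_def valgrp_def
    by (intro CollectI exI[of _ "j - i"]) (auto intro!: exI[of _ "a i / a j"])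
qed

end

subsection \<open>Families of key polynomials\<close>

text \<open>Each line \<open>x \<mapsto> B j + j x\<close> is minimal on an interval, so one of the finitely many lines is
  minimal at three of the given points, and it wins by a margin at the middle one.\<close>

lemma exists_dominant_line:
  fixes B :: "nat \<Rightarrow> 'g::linordered_ab_group_add extended" and \<gamma> :: "nat \<Rightarrow> 'g"
  assumes B: "\<And>j. B j \<noteq> Minf" "B t = Fin bt" and \<delta>: "0 \<le> \<delta>" and \<gamma>: "\<And>i. \<gamma> i + \<delta> < \<gamma> (Suc i)"
  obtains i j0 b0 where "i \<in> {1..2 * t + 3}" "j0 \<le> t" "B j0 = Fin b0"
    "b0 + nmul j0 (\<gamma> i) \<le> bt + nmul t (\<gamma> i)"
    "\<And>j. j \<le> t \<Longrightarrow> j \<noteq> j0 \<Longrightarrow> Fin (b0 + nmul j0 (\<gamma> i) + \<delta>) < B j + Fin (nmul j (\<gamma> i))"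
proof -
  define a where "a i = arg_min_on (\<lambda>j. B j + Fin (nmul j (\<gamma> i))) {..t}" for i
  have a: "a i \<le> t" "j \<le> t \<Longrightarrow> B (a i) + Fin (nmul (a i) (\<gamma> i)) \<le> B j + Fin (nmul j (\<gamma> i))" for i j
    using arg_min_if_finite[of "{..t}" "\<lambda>j. B j + Fin (nmul j (\<gamma> i))"]
    by (auto simp: a_def not_less)
  \<comment> \<open>There are \<open>t + 1\<close> lines and \<open>2 * t + 3 > 2 * (t + 1)\<close>
    points, so some line is chosen at least three times.\<close>
  have "\<exists>y\<in>{..t}. card (a -` {y} \<inter> {1..2 * t + 3}) * card {..t} \<ge> card {1..2 * t + 3}"
    by (intro pigeonhole_card) (auto simp: a)
  then obtain y where y: "y \<le> t" "card (a -` {y} \<inter> {1..2 * t + 3}) * Suc t \<ge> 2 * t + 3" by auto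
  define X where "X = a -` {y} \<inter> {1..2 * t + 3}"
  have "3 \<le> card X"
  proof (rule ccontr)
    assume "\<not> 3 \<le> card X"
    then have "card X * Suc t \<le> 2 * Suc t" by (intro mult_right_mono) auto
    then show False using y by (simp add: X_def)
  qed
  have X: "finite X" "X \<noteq> {}" using \<open>3 \<le> card X\<close> by (auto simp: X_def)
  have "card (X - {Min X, Max X}) \<noteq> 0"
    using \<open>3 \<le> card X\<close> X card_Diff_subset[of "{Min X, Max X}" X] card_insert_le_m1[of 2 "{Max X}" "Min X"]
    by (auto simp: Max_in Min_in)
  \<comment> \<open>A point other than the first and the last leaves a point of comparison on each
    side.\<close>
  then obtain i where i: "i \<in> X" "i \<noteq> Min X" "i \<noteq> Max X" by (metis Diff_iff card.empty ex_in_conv insertCI)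
  define i1 i3 where "i1 = Min X" and "i3 = Max X"
  have "i1 \<le> i" "i \<le> i3" using X i by (auto simp: i1_def i3_def)
  then have less: "i1 < i" "i < i3" using i by (auto simp: i1_def i3_def)
  have "i1 \<in> X" "i3 \<in> X" using X by (auto simp: i1_def i3_def)
  then have ai: "a i1 = y" "a i = y" "a i3 = y" using i by (auto simp: X_def)
  have mono: "\<gamma> k + \<delta> < \<gamma> k'" if "k < k'" for k k'
  proof -
    have "\<gamma> n \<le> \<gamma> (Suc n)" for n
      using \<gamma>[of n] \<delta> by (meson le_add_same_cancel1 le_less_trans less_imp_le)
    from lift_Suc_mono_le[of \<gamma>, OF this, of "Suc k" k'] have "\<gamma> (Suc k) \<le> \<gamma> k'" using that by simp
    then show ?thesis using \<gamma>[of k] by simp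
  qed
  have "B y \<noteq> Pinf" using a(2)[of t i] ai B by (cases "B y") auto
  then obtain b0 where b0: "B y = Fin b0" using B(1)[of y] by (cases "B y") auto
  show ?thesis
  proof (rule that[of i y b0])
    show "i \<in> {1..2 * t + 3}" using i by (simp add: X_def)
    show "b0 + nmul y (\<gamma> i) \<le> bt + nmul t (\<gamma> i)" using a(2)[of t i] ai b0 B by simp
    fix j assume j: "j \<le> t" "j \<noteq> y"
    show "Fin (b0 + nmul y (\<gamma> i) + \<delta>) < B j + Fin (nmul j (\<gamma> i))"
    proof (cases "B j")
      case (Fin b)
      have le1: "b0 + nmul y (\<gamma> i1) \<le> b + nmul j (\<gamma> i1)" using a(2)[of j i1] ai j b0 Fin by simp
      have le3: "b0 + nmul y (\<gamma> i3) \<le> b + nmul j (\<gamma> i3)" using a(2)[of j i3] ai j b0 Fin by simp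
      have "b0 + nmul y (\<gamma> i) + \<delta> < b + nmul j (\<gamma> i)"
      proof (cases "y < j")
        \<comment> \<open>Line \<open>j\<close> is steeper: it is not below line \<open>y\<close> at
          \<open>i1\<close>, and from there to \<open>i\<close> its lead grows by
          \<open>nmul (j - y) x\<close>, which exceeds \<open>\<delta>\<close>.\<close>
        case True
        define x where "x = \<gamma> i - \<gamma> i1"
        have "\<delta> < x" using mono[OF less(1)] by (simp add: x_def algebra_simps)
        also have "x \<le> nmul (j - y) x" using \<open>\<delta> < x\<close> \<delta> True by (intro nmul_ge_self) auto
        finally have d: "\<delta> < nmul (j - y) x" .
        have "nmul j x = nmul y x + nmul (j - y) x" using nmul_add[of y "j - y" x] True by simp
        then have e: "nmul j (\<gamma> i) = nmul j (\<gamma> i1) + nmul y (\<gamma> i) - nmul y (\<gamma> i1) + nmul (j - y) x"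
          by (simp add: x_def nmul_diff_right algebra_simps)
        have "b0 + nmul y (\<gamma> i) + \<delta> = (b0 + nmul y (\<gamma> i1)) + (nmul y (\<gamma> i) - nmul y (\<gamma> i1) + \<delta>)"
          by simp
        also have "\<dots> < (b + nmul j (\<gamma> i1)) + (nmul y (\<gamma> i) - nmul y (\<gamma> i1) + nmul (j - y) x)"
          using le1 d by (intro add_le_less_mono) auto
        also have "\<dots> = b + nmul j (\<gamma> i)" using e by (simp add: algebra_simps)
        finally show ?thesis .
      next
        \<comment> \<open>For a flatter line the same comparison runs backwards from
          \<open>i3\<close> to \<open>i\<close>.\<close>
        case False
        then have "j < y" using j by simp
        define x where "x = \<gamma> i3 - \<gamma> i"
        have "\<delta> < x" using mono[OF less(2)] by (simp add: x_def algebra_simps)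
        also have "x \<le> nmul (y - j) x" using \<open>\<delta> < x\<close> \<delta> \<open>j < y\<close> by (intro nmul_ge_self) auto
        finally have d: "\<delta> < nmul (y - j) x" .
        have "nmul y x = nmul j x + nmul (y - j) x" using nmul_add[of j "y - j" x] \<open>j < y\<close> by simp
        then have e: "nmul j (\<gamma> i) = nmul j (\<gamma> i3) + nmul y (\<gamma> i) - nmul y (\<gamma> i3) + nmul (y - j) x"
          by (simp add: x_def nmul_diff_right algebra_simps)
        have "b0 + nmul y (\<gamma> i) + \<delta> = (b0 + nmul y (\<gamma> i3)) + (nmul y (\<gamma> i) - nmul y (\<gamma> i3) + \<delta>)"
          by simp
        also have "\<dots> < (b + nmul j (\<gamma> i3)) + (nmul y (\<gamma> i) - nmul y (\<gamma> i3) + nmul (y - j) x)"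
          using le3 d by (intro add_le_less_mono) auto
        also have "\<dots> = b + nmul j (\<gamma> i)" using e by (simp add: algebra_simps)
        finally show ?thesis .
      qed
      then show ?thesis using Fin by simp
    qed (use B(1)[of j] in auto)
  qed (use y b0 in auto)
qed

section \<open>Truncated values along a family of key polynomials\<close>

locale key_family = poly_valuation \<nu>
  for \<nu> :: "'k::field poly \<Rightarrow> 'g::linordered_ab_group_add extended" +
  fixes Qs :: "'k poly set" and m :: nat and \<gamma> :: "'k poly \<Rightarrow> 'g"
  assumes key: "Q \<in> Qs \<Longrightarrow> \<exists>d. simple_key \<nu> Q (\<gamma> Q) d"
    and deg: "Q \<in> Qs \<Longrightarrow> degree Q = m"
begin

lemma pos: "Q \<in> Qs \<Longrightarrow> 0 < degree Q"
  and monic: "Q \<in> Qs \<Longrightarrow> lead_coeff Q = 1"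
  and val_Q: "Q \<in> Qs \<Longrightarrow> \<nu> Q = Fin (\<gamma> Q)"
  using key by (auto simp: simple_key_def)

lemma small_fin:
  assumes "Q \<in> Qs" "degree f < m" "f \<noteq> 0" obtains a where "\<nu> f = Fin a"
  using key[OF assms(1)] deg[OF assms(1)] assms(2,3) by (auto simp: simple_key_def)

lemma degree_diff: "P \<in> Qs \<Longrightarrow> Q \<in> Qs \<Longrightarrow> degree (P - Q) < m"
  using monic_diff_degree[of P Q] monic[of P] monic[of Q] deg[of P] deg[of Q] pos[of Q] by simp

lemma carry_bound_of: "R \<in> Qs \<Longrightarrow> Q \<in> Qs \<Longrightarrow> \<gamma> R \<le> \<gamma> Q \<Longrightarrow> carry_bound \<nu> Q (\<gamma> R)"
  using key[of R] key[of Q] deg[of R] deg[of Q] by (auto intro: simple_key_carry_bound)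

text \<open>The smaller weight \<open>\<gamma> R\<close> is kept: \<open>weight_ge_mono_of\<close>
  discards the resulting gain, whereas \<open>nuQ_growth\<close> exploits it.\<close>

lemma weight_ge_change_of:
  assumes "R \<in> Qs" "Q \<in> Qs" "\<gamma> R \<le> \<gamma> Q" "weight_ge \<nu> R (\<gamma> R) c f"
  shows "weight_ge \<nu> Q (\<gamma> R) c f"
proof -
  interpret carry_bound \<nu> Q "\<gamma> R" using carry_bound_of assms by auto
  have "Fin (\<gamma> R) \<le> \<nu> (R - Q)" using assms by (intro val_diff_ge) (auto simp: val_Q)
  then show ?thesis
    using weight_ge_change[of R c f] assms degree_diff[of R Q] by (simp add: deg)
qed

lemma weight_ge_mono_of:
  assumes "R \<in> Qs" "Q \<in> Qs" "\<gamma> R \<le> \<gamma> Q" "weight_ge \<nu> R (\<gamma> R) c f"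
  shows "weight_ge \<nu> Q (\<gamma> Q) c f"
  using weight_ge_change_of[OF assms] assms(3) by (rule weight_ge_mono2)

lemma nuQ_ge_iff:
  assumes "Q \<in> Qs" shows "Fin c \<le> nuQ \<nu> Q f \<longleftrightarrow> weight_ge \<nu> Q (\<gamma> Q) c f"
proof -
  have *: "Fin c \<le> \<nu> (expc Q f i * Q ^ i) \<longleftrightarrow> Fin (c - nmul i (\<gamma> Q)) \<le> \<nu> (expc Q f i)" for i
    using val_power[OF val_Q[OF assms], of i]
    by (cases "\<nu> (expc Q f i)") (auto simp: val_mult algebra_simps)
  \<comment> \<open>Coefficients beyond \<open>degree f\<close> vanish, so the finite minimum in
    \<open>nuQ\<close> may be taken over all indices.\<close>
  have **: "expc Q f i = 0" if "degree f < i" for i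
  proof -
    have "degree f < i * 1" using that by simp
    also have "\<dots> \<le> i * degree Q" using pos[OF assms] by (intro mult_left_mono) auto
    finally have "degree f < i * degree Q" .
    then show ?thesis using pos[OF assms] by (intro expc_eq_0)
  qed
  have "Fin c \<le> nuQ \<nu> Q f \<longleftrightarrow> (\<forall>i\<in>{0..degree f}. Fin (c - nmul i (\<gamma> Q)) \<le> \<nu> (expc Q f i))"
    unfolding nuQ_def by (subst Min_ge_iff) (auto simp: *)
  also have "\<dots> \<longleftrightarrow> weight_ge \<nu> Q (\<gamma> Q) c f"
    unfolding weight_ge_def
  proof (intro iffI ballI allI)
    fix i
    assume "\<forall>i\<in>{0..degree f}. Fin (c - nmul i (\<gamma> Q)) \<le> \<nu> (expc Q f i)"
    then show "Fin (c - nmul i (\<gamma> Q)) \<le> \<nu> (expc Q f i)" using **[of i] by (cases "i \<le> degree f") auto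
  qed auto
  finally show ?thesis .
qed

lemma nuQ_le_val:
  assumes "Q \<in> Qs" shows "nuQ \<nu> Q f \<le> \<nu> f"
proof -
  have "f = (\<Sum>i\<le>degree f. expc Q f i * Q ^ i)"
    using pos[OF assms] by (rule expansion_sum_degree)
  moreover have "nuQ \<nu> Q f \<le> \<nu> (\<Sum>i\<le>degree f. expc Q f i * Q ^ i)"
    by (intro val_sum_ge) (auto simp: nuQ_def)
  ultimately show ?thesis by simp
qed

lemma nuQ_ne_Minf: "nuQ \<nu> Q f \<noteq> Minf"
proof -
  have "nuQ \<nu> Q f \<in> (\<lambda>i. \<nu> (expc Q f i * Q ^ i)) ` {0..degree f}"
    unfolding nuQ_def by (intro Min_in) auto
  then show ?thesis using val_ne_Minf by (metis (no_types, lifting) imageE)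
qed

text \<open>Truncated values grow along the family and never exceed \<open>\<nu> f\<close>, so
  equality persists once it holds.\<close>

lemma stable_from:
  assumes "R \<in> Qs" "Q \<in> Qs" "\<gamma> R \<le> \<gamma> Q" "nuQ \<nu> R f = \<nu> f"
  shows "nuQ \<nu> Q f = \<nu> f"
proof (rule antisym[OF nuQ_le_val[OF assms(2)]])
  have *: "Fin c \<le> nuQ \<nu> Q f" if "Fin c \<le> \<nu> f" for c
    using that weight_ge_mono_of[OF assms(1-3), of c f] assms
    by (simp flip: nuQ_ge_iff[OF assms(1)] nuQ_ge_iff[OF assms(2)])
  show "\<nu> f \<le> nuQ \<nu> Q f"
  proof (cases "\<nu> f")
    \<comment> \<open>Nonzero digits have finite value, so an infinite truncated value forces
      \<open>f = 0\<close>.\<close>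
    case Pinf
    have P: "\<nu> (expc R f i * R ^ i) = Pinf" if "i \<le> degree f" for i
    proof -
      have "nuQ \<nu> R f \<le> \<nu> (expc R f i * R ^ i)"
        unfolding nuQ_def using that by (intro Min_le) auto
      then show ?thesis using assms(4) Pinf by simp
    qed
    have "expc R f i = 0" if "i \<le> degree f" for i
    proof -
      have "\<nu> (expc R f i) \<noteq> Fin a" for a
        using P[OF that] val_power[OF val_Q[OF assms(1)], of i] by (auto simp: val_mult)
      then show ?thesis
        using small_fin[OF assms(1), of "expc R f i"] degree_expc[OF pos[OF assms(1)], of f i]
        by (auto simp: deg[OF assms(1)])
    qed
    then have "f = 0" using expansion_sum_degree[OF pos[OF assms(1)], of f] by simp
    then show ?thesis by (simp add: nuQ_def)
  qed (use * in auto)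
qed

end

section \<open>Truncated values of a limit key polynomial\<close>

locale limit_family = key_family +
  fixes F
  assumes unstable: "R \<in> Qs \<Longrightarrow> nuQ \<nu> R F \<noteq> \<nu> F"
    and minimal: "lead_coeff g = 1 \<Longrightarrow> degree g < degree F \<Longrightarrow>
       \<exists>R0\<in>Qs. \<forall>R\<in>Qs. \<gamma> R0 \<le> \<gamma> R \<longrightarrow> nuQ \<nu> R g = \<nu> g"
begin

text \<open>Scaling makes \<open>g\<close> monic, and the scaling constant is multiplied back as a
  digit. The case \<open>g = 0\<close> is included for a remainder that vanishes.\<close>

lemma minimal_weight:
  assumes "Qs \<noteq> {}" "g = 0 \<or> degree g < degree F"
  obtains R0 where "R0 \<in> Qs" "\<And>R c. R \<in> Qs \<Longrightarrow> \<gamma> R0 \<le> \<gamma> R \<Longrightarrow> Fin c \<le> \<nu> g \<Longrightarrow> weight_ge \<nu> R (\<gamma> R) c g"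
proof (cases "g = 0")
  case True
  then show ?thesis using that assms(1) by fastforce
next
  case False
  define a where "a = lead_coeff g"
  define g' where "g' = smult (inverse a) g"
  have a: "a \<noteq> 0" using False by (simp add: a_def)
  have "lead_coeff g' = 1" "degree g' < degree F"
    using a assms False by (auto simp: g'_def) (auto simp: a_def)
  then obtain R0 where R0: "R0 \<in> Qs" "\<And>R. R \<in> Qs \<Longrightarrow> \<gamma> R0 \<le> \<gamma> R \<Longrightarrow> nuQ \<nu> R g' = \<nu> g'"
    using minimal by blast
  have g: "g = [:a:] * g'" using a by (simp add: g'_def)
  obtain x where x: "\<nu> [:a:] = Fin x" using a by (rule val_const_fin)
  have "weight_ge \<nu> R (\<gamma> R) c g" if R: "R \<in> Qs" "\<gamma> R0 \<le> \<gamma> R" "Fin c \<le> \<nu> g" for R c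
  proof -
    have "Fin (c - x) \<le> \<nu> g'" using R(3) x unfolding g val_mult by (cases "\<nu> g'") (auto simp: algebra_simps)
    then have w: "weight_ge \<nu> R (\<gamma> R) (c - x) g'" using R0(2)[OF R(1,2)] nuQ_ge_iff[OF R(1)] by metis
    interpret carry_bound \<nu> R "\<gamma> R" using carry_bound_of R by auto
    show ?thesis
      using weight_ge_mult_small[of "[:a:]" x "c - x" g'] w x degree_pos by (simp add: g)
  qed
  then show ?thesis using that R0(1) by blast
qed

text \<open>Otherwise \<open>F\<close> would be stable together with its remainder modulo \<open>P\<^sup>D\<close>, which has smaller degree.\<close>

lemma top_term_le:
  assumes P: "P \<in> Qs" and F: "F \<noteq> 0"
  obtains R where "R \<in> Qs" "\<nu> (expc P F (degree F div m) * P ^ (degree F div m)) \<le> nuQ \<nu> R F"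
proof (rule ccontr)
  define D where "D = degree F div m"
  define f where "f = F div P ^ D"
  define S where "S = F mod P ^ D"
  assume "\<not> thesis"
  then have less: "nuQ \<nu> R F < \<nu> (expc P F D * P ^ D)" if "R \<in> Qs" for R
    using that \<open>\<And>R. R \<in> Qs \<Longrightarrow> _ \<Longrightarrow> thesis\<close> unfolding D_def by (meson not_le)
  have m: "0 < m" "P \<noteq> 0" using pos[OF P] deg[OF P] by auto
  have degPD: "degree (P ^ D) = D * m" using m deg[OF P] by (simp add: degree_power_eq)
  have f: "degree f < m"
  proof (cases "D = 0")
    case True
    then show ?thesis using m by (auto simp: f_def D_def div_eq_0_iff)
  next
    case False
    then have "degree f = degree F - D * m"
      using degPD m by (simp add: f_def degree_div_poly)
    then show ?thesis using m by (simp add: D_def minus_div_mult_eq_mod)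
  qed
  have "expc P F D = f" using f by (simp add: expc_def f_def deg[OF P] mod_poly_less)
  have "degree (P ^ D) \<le> degree F" unfolding degPD by (simp add: D_def)
  then have "f \<noteq> 0" using F m by (simp add: f_def div_poly_eq_0_iff)
  then obtain a where a: "\<nu> f = Fin a" using small_fin P f by blast
  define \<alpha> where "\<alpha> = a + nmul D (\<gamma> P)"
  have \<alpha>: "\<nu> (f * P ^ D) = Fin \<alpha>" using a val_power[OF val_Q[OF P]] by (simp add: val_mult \<alpha>_def)
  have wA: "weight_ge \<nu> P (\<gamma> P) \<alpha> (f * P ^ D)"
    using a f m deg[OF P] unfolding weight_ge_def
    by (auto simp: expc_mult_power expc_small \<alpha>_def)
  have S: "S = 0 \<or> degree S < degree F"
  proof (cases "D = 0")
    case True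
    then show ?thesis by (simp add: S_def)
  next
    case False
    then have "degree S < D * m"
      using degree_mod_less_pos[of "P ^ D" F] m by (simp add: S_def degPD)
    then show ?thesis using degPD \<open>degree (P ^ D) \<le> degree F\<close> by simp
  qed
  obtain R0 where R0: "R0 \<in> Qs"
    "\<And>R c. R \<in> Qs \<Longrightarrow> \<gamma> R0 \<le> \<gamma> R \<Longrightarrow> Fin c \<le> \<nu> S \<Longrightarrow> weight_ge \<nu> R (\<gamma> R) c S"
    using minimal_weight[OF _ S] P by blast
  obtain R where R: "R \<in> Qs" "\<gamma> R0 \<le> \<gamma> R" "\<gamma> P \<le> \<gamma> R"
    using P R0(1) by (metis linear order_refl)
  have eq: "F = f * P ^ D + S" by (simp only: f_def S_def div_mult_mod_eq)
  have lt: "nuQ \<nu> R F < Fin \<alpha>" using less[OF R(1)] \<alpha> \<open>expc P F D = f\<close> by simp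
  then obtain \<rho> where \<rho>: "nuQ \<nu> R F = Fin \<rho>" "\<rho> < \<alpha>" using nuQ_ne_Minf by (cases "nuQ \<nu> R F") auto
  \<comment> \<open>Instability makes \<open>\<nu> F\<close> exceed the truncated value strictly,
    and \<open>S\<close> inherits this strict bound.\<close>
  have "Fin \<rho> < \<nu> F" using nuQ_le_val[OF R(1), of F] unstable[OF R(1)] \<rho> by simp
  then have "Fin \<rho> < \<nu> (F - f * P ^ D)" using \<alpha> \<rho> by (intro val_diff_gt) auto
  then have gt: "Fin \<rho> < \<nu> S" by (simp add: eq)
  \<comment> \<open>A bound above \<open>\<rho>\<close> common to both summands of \<open>F\<close>;
    \<open>\<alpha>\<close> alone serves when \<open>S\<close> has infinite value.\<close>
  define \<rho>' where "\<rho>' = (case \<nu> S of Fin s \<Rightarrow> min s \<alpha> | _ \<Rightarrow> \<alpha>)"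
  have \<rho>': "\<rho> < \<rho>'" "Fin \<rho>' \<le> \<nu> S" "\<rho>' \<le> \<alpha>" using gt \<rho> by (auto simp: \<rho>'_def split: extended.splits)
  have "weight_ge \<nu> R (\<gamma> R) \<rho>' (f * P ^ D)"
    using weight_ge_mono_of[OF P R(1,3) wA] \<rho>'(3) by (rule weight_ge_mono)
  then have "weight_ge \<nu> R (\<gamma> R) \<rho>' F"
    unfolding eq using R0(2)[OF R(1,2) \<rho>'(2)] by (rule weight_ge_add)
  then have "Fin \<rho>' \<le> nuQ \<nu> R F" using nuQ_ge_iff[OF R(1)] by simp
  then show False using \<rho> \<rho>' by simp
qed

text \<open>With weight \<open>\<gamma> R\<close> kept, each term of index at least one gains
  \<open>\<gamma> R' - \<gamma> R\<close>. If the digit of index zero had too small a value, it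
  would be the only minimal term, giving \<open>nuQ \<nu> R' F = \<nu> F\<close> against
  instability.\<close>

lemma nuQ_growth:
  assumes R: "R \<in> Qs" "R' \<in> Qs" "\<gamma> R \<le> \<gamma> R'" and \<rho>: "Fin \<rho> \<le> nuQ \<nu> R F"
  shows "Fin (\<rho> + (\<gamma> R' - \<gamma> R)) \<le> nuQ \<nu> R' F"
proof -
  define x where "x = \<gamma> R' - \<gamma> R"
  have x: "0 \<le> x" using R by (simp add: x_def)
  have w: "weight_ge \<nu> R' (\<gamma> R) \<rho> F"
    using weight_ge_change_of[OF R] \<rho> nuQ_ge_iff[OF R(1)] by blast
  have high: "Fin (\<rho> + x - nmul i (\<gamma> R')) \<le> \<nu> (expc R' F i)" if "i \<noteq> 0" for i
  proof -
    have "x \<le> nmul i x" using x that by (rule nmul_ge_self)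
    then have "\<rho> + x - nmul i (\<gamma> R') \<le> \<rho> - nmul i (\<gamma> R)"
      by (simp add: x_def nmul_diff_right algebra_simps)
    then have "Fin (\<rho> + x - nmul i (\<gamma> R')) \<le> Fin (\<rho> - nmul i (\<gamma> R))" by simp
    also have "\<dots> \<le> \<nu> (expc R' F i)" using w by (simp add: weight_ge_def)
    finally show ?thesis .
  qed
  have wQ: "weight_ge \<nu> R' (\<gamma> R') c F" if "c \<le> \<rho> + x" "Fin c \<le> \<nu> (F mod R')" for c
    unfolding weight_ge_def
  proof
    fix i
    show "Fin (c - nmul i (\<gamma> R')) \<le> \<nu> (expc R' F i)"
    proof (cases "i = 0")
      case False
      have "Fin (c - nmul i (\<gamma> R')) \<le> Fin (\<rho> + x - nmul i (\<gamma> R'))" using that(1) by simp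
      also note high[OF False]
      finally show ?thesis .
    qed (use that in \<open>simp add: expc_0\<close>)
  qed
  have "Fin (\<rho> + x) \<le> \<nu> (F mod R')"
  proof (rule ccontr)
    assume "\<not> ?thesis"
    then obtain \<mu> where \<mu>: "\<nu> (F mod R') = Fin \<mu>" "\<mu> < \<rho> + x" by (cases "\<nu> (F mod R')") auto
    have "Fin \<mu> \<le> nuQ \<nu> R' F" using wQ[of \<mu>] \<mu> nuQ_ge_iff[OF R(2)] by auto
    moreover have "\<nu> F = Fin \<mu>"
    proof -
      have "weight_ge \<nu> R' (\<gamma> R') (\<rho> + x) (R' * (F div R'))"
        unfolding weight_ge_def
      proof
        fix i
        show "Fin (\<rho> + x - nmul i (\<gamma> R')) \<le> \<nu> (expc R' (R' * (F div R')) i)"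
          using high[of i] pos[OF R(2)] by (cases i) (auto simp: expc_0 expc_Suc)
      qed
      then have "Fin (\<rho> + x) \<le> \<nu> (R' * (F div R'))"
        using weight_ge_imp_val_ge[OF pos[OF R(2)], of "\<gamma> R'"] val_Q[OF R(2)] by simp
      then have "Fin \<mu> < \<nu> (R' * (F div R'))" using \<mu>(2) by (cases "\<nu> (R' * (F div R'))") auto
      then have "\<nu> (F mod R' + R' * (F div R')) = Fin \<mu>" using \<mu> by (intro val_add_eq)
      then show ?thesis by simp
    qed
    ultimately show False using nuQ_le_val[OF R(2), of F] unstable[OF R(2)] by simp
  qed
  then show ?thesis using wQ[of "\<rho> + x"] nuQ_ge_iff[OF R(2)] by (simp add: x_def)
qed

end

section \<open>Expansions in two different key polynomials\<close>

context key_family begin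

lemma val_diff_Q:
  assumes "P \<in> Qs" "Q \<in> Qs" "\<gamma> Q < \<gamma> P" shows "\<nu> (P - Q) = Fin (\<gamma> Q)"
  using val_add_eq[of "- Q" "\<gamma> Q" P] assms by (simp add: val_Q)

text \<open>Write \<open>P = Q + h\<close> and expand \<open>f P\<^sup>i\<close> binomially: the powers \<open>Q\<^sup>k\<close> with \<open>k < l\<close> reach the
  \<open>l\<close>-th coefficient only through carries, and each carry gains at least \<open>\<gamma> Q - \<gamma> Q0\<close>.\<close>

lemma expc_change:
  assumes Q0: "Q0 \<in> Qs" and Q: "Q \<in> Qs" and P: "P \<in> Qs"
    and \<delta>: "0 \<le> \<delta>" "\<gamma> Q0 + \<delta> < \<gamma> Q" and QP: "\<gamma> Q < \<gamma> P"
    and f: "degree f < m" "\<nu> f = Fin b"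
  obtains main err where
    "expc Q (f * P ^ (l + j)) l = of_nat ((l + j) choose l) * main + err"
    "\<nu> main = Fin (b + nmul j (\<gamma> Q))" "Fin (b + nmul j (\<gamma> Q) + \<delta>) < \<nu> err"
proof -
  have "\<gamma> Q0 \<le> \<gamma> Q" using \<delta> by (meson le_add_same_cancel1 le_less_trans less_imp_le)
  then interpret carry_bound \<nu> Q "\<gamma> Q0" using Q0 Q by (intro carry_bound_of)
  define i where "i = l + j"
  define h where "h = P - Q"
  define summand where "summand = (\<lambda>k. smult (of_nat (i choose k)) (expc Q (f * h ^ (i - k) * Q ^ k) l))"
  have h: "degree h < degree Q" "\<nu> h = Fin (\<gamma> Q)"
    using degree_diff[OF P Q] val_diff_Q[OF P Q QP] deg[OF Q] by (auto simp: h_def)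
  have fQ: "degree f < degree Q" using f deg[OF Q] by simp
  have nz: "Q \<noteq> 0" using pos[OF Q] by auto
  have "f * P ^ i = f * (Q + h) ^ i" by (simp add: h_def)
  also have "\<dots> = (\<Sum>k\<le>i. smult (of_nat (i choose k)) (f * h ^ (i - k) * Q ^ k))"
    by (simp add: binomial_ring sum_distrib_left of_nat_poly ac_simps)
  finally have "expc Q (f * P ^ i) l = (\<Sum>k\<le>i. summand k)"
    by (simp add: expc_sum expc_smult summand_def)
  \<comment> \<open>Multiples of \<open>Q ^ k\<close> with \<open>k > l\<close> have a zero digit at
    index \<open>l\<close>.\<close>
  also have "\<dots> = (\<Sum>k\<le>l. summand k)"
    by (rule sum.mono_neutral_right) (auto simp: i_def summand_def expc_mult_power[OF nz])
  also have "\<dots> = summand l + (\<Sum>k<l. summand k)"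
    by (simp add: lessThan_Suc_atMost[symmetric] add.commute)
  also have "summand l = of_nat (i choose l) * ((f * h ^ j) mod Q)"
    by (simp add: summand_def expc_mult_power[OF nz] expc_0 of_nat_poly i_def)
  finally have eq: "expc Q (f * P ^ (l + j)) l =
     of_nat ((l + j) choose l) * ((f * h ^ j) mod Q) + (\<Sum>k<l. summand k)" by (simp add: i_def)
  have main: "\<nu> ((f * h ^ j) mod Q) = Fin (b + nmul j (\<gamma> Q))"
    using key[OF Q] fQ f(2) h simple_key_mod_mult_power by blast
  have "Fin (b + nmul j (\<gamma> Q) + \<delta>) < \<nu> (summand k)" if k: "k < l" for k
  proof -
    have "weight_ge \<nu> Q (\<gamma> Q0) (b + nmul (i - k) (\<gamma> Q)) (f * h ^ (i - k))"
      using h fQ f(2) by (intro weight_ge_mult_power_small weight_ge_small) auto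
    then have "Fin (b + nmul (i - k) (\<gamma> Q) - nmul (l - k) (\<gamma> Q0)) \<le> \<nu> (expc Q (f * h ^ (i - k)) (l - k))"
      by (simp add: weight_ge_def)
    then have "Fin (0 + (b + nmul (i - k) (\<gamma> Q) - nmul (l - k) (\<gamma> Q0))) \<le> \<nu> (summand k)"
      using k val_mult_ge[OF val_of_nat_nonneg]
      by (simp add: summand_def expc_mult_power[OF nz] of_nat_poly)
    moreover have "b + nmul j (\<gamma> Q) + \<delta> < b + nmul (i - k) (\<gamma> Q) - nmul (l - k) (\<gamma> Q0)"
    proof -
      define x where "x = \<gamma> Q - \<gamma> Q0"
      have "\<delta> < x" using \<delta> by (simp add: x_def algebra_simps)
      also have "x \<le> nmul (l - k) x" using \<open>\<delta> < x\<close> \<delta>(1) k by (intro nmul_ge_self) auto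
      finally have "\<delta> < nmul (l - k) (\<gamma> Q) - nmul (l - k) (\<gamma> Q0)" by (simp add: x_def nmul_diff_right)
      moreover have "i - k = j + (l - k)" using k by (simp add: i_def)
      ultimately show ?thesis by (simp add: nmul_add algebra_simps)
    qed
    ultimately show ?thesis
      unfolding add_0_left using less_le_trans less_extended_simps(1) by metis
  qed
  then have "Fin (b + nmul j (\<gamma> Q) + \<delta>) < \<nu> (\<Sum>k<l. summand k)" by (intro val_sum_gt) auto
  then show ?thesis using that eq main by blast
qed

text \<open>Among the summands of index at least \<open>l\<close>, all but \<open>j0\<close>
  contribute values above \<open>b0 + nmul j0 (\<gamma> Q) + \<delta>\<close>, since integer factors
  cannot lower a value. The binomial coefficient raises the value of the summand \<open>j0\<close>
  by at most \<open>\<delta>\<close>, so that summand decides.\<close>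

lemma expc_val_of_dominant:
  assumes Q0: "Q0 \<in> Qs" and Q: "Q \<in> Qs" and P: "P \<in> Qs"
    and \<delta>: "0 \<le> \<delta>" "\<gamma> Q0 + \<delta> < \<gamma> Q" and QP: "\<gamma> Q < \<gamma> P"
    and n: "degree F < Suc (l + t) * m"
    and j0: "j0 \<le> t" "\<nu> (expc P F (l + j0)) = Fin b0"
    and binom: "\<nu> (of_nat ((l + j0) choose l)) \<le> Fin \<delta>"
    and dom: "\<And>j. j \<le> t \<Longrightarrow> j \<noteq> j0 \<Longrightarrow>
       Fin (b0 + nmul j0 (\<gamma> Q) + \<delta>) < \<nu> (expc P F (l + j)) + Fin (nmul j (\<gamma> Q))"
  obtains b where "\<nu> (expc Q F l) = Fin b" "b \<le> b0 + nmul j0 (\<gamma> Q) + \<delta>"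
proof -
  define X where "X = b0 + nmul j0 (\<gamma> Q)"
  define T where "T j = expc Q (expc P F (l + j) * P ^ (l + j)) l" for j
  have mP: "degree P = m" "0 < m" using pos[OF P] deg[OF P] by auto
  have small: "degree (expc P F i) < m" for i using degree_expc[of P F i] mP by simp
  have F: "F = (\<Sum>i\<le>l + t. expc P F i * P ^ i)" using n mP by (intro expansion_sum) auto
  \<comment> \<open>The \<open>i\<close>-th term has degree below \<open>Suc i * m\<close>, so it
    cannot reach index \<open>l\<close>.\<close>
  have low: "expc Q (expc P F i * P ^ i) l = 0" if "i < l" for i
  proof (rule expc_eq_0)
    have "degree (expc P F i * P ^ i) \<le> degree (expc P F i) + i * m"
      using degree_mult_le[of "expc P F i" "P ^ i"] degree_power_le[of P i] mP
      by (simp add: mult.commute)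
    also have "\<dots> < Suc i * m" using small[of i] by simp
    also have "\<dots> \<le> l * m" using that by (intro mult_right_mono) auto
    finally show "degree (expc P F i * P ^ i) < l * degree Q" using deg[OF Q] by simp
  qed (use pos[OF Q] in auto)
  have "expc Q F l = (\<Sum>i\<le>l + t. expc Q (expc P F i * P ^ i) l)"
    using arg_cong[OF F, of "\<lambda>f. expc Q f l"] by (simp add: expc_sum)
  also have "\<dots> = (\<Sum>i\<in>{l..l + t}. expc Q (expc P F i * P ^ i) l)"
    by (rule sum.mono_neutral_right) (auto simp: low)
  also have "\<dots> = (\<Sum>j\<le>t. T j)"
    unfolding T_def by (rule sum.reindex_bij_witness[of _ "\<lambda>j. l + j" "\<lambda>i. i - l"]) auto
  also have "\<dots> = T j0 + (\<Sum>j\<in>{..t} - {j0}. T j)" using j0 by (simp add: sum.remove)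
  finally have eq: "expc Q F l = T j0 + (\<Sum>j\<in>{..t} - {j0}. T j)" .
  have "Fin (X + \<delta>) < \<nu> (T j)" if j: "j \<le> t" "j \<noteq> j0" for j
  proof (cases "expc P F (l + j) = 0")
    case True
    then show ?thesis by (simp add: T_def)
  next
    case False
    then obtain b where b: "\<nu> (expc P F (l + j)) = Fin b" using small_fin[OF P small] by blast
    have less: "X + \<delta> < b + nmul j (\<gamma> Q)" using dom[OF j] b by (simp add: X_def)
    obtain main err where me: "T j = of_nat ((l + j) choose l) * main + err"
      "\<nu> main = Fin (b + nmul j (\<gamma> Q))" "Fin (b + nmul j (\<gamma> Q) + \<delta>) < \<nu> err"
      unfolding T_def using expc_change[OF Q0 Q P \<delta> QP small b] by blast
    have "Fin (0 + (b + nmul j (\<gamma> Q))) \<le> \<nu> (of_nat ((l + j) choose l) * main)"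
      using me by (intro val_mult_ge val_of_nat_nonneg) auto
    then have "Fin (X + \<delta>) < \<nu> (of_nat ((l + j) choose l) * main)"
      using less by (cases "\<nu> (of_nat ((l + j) choose l) * main)") auto
    moreover have "X + \<delta> < b + nmul j (\<gamma> Q) + \<delta>" using less \<delta>(1) by (simp add: add_strict_increasing2 add.commute)
    then have "Fin (X + \<delta>) < \<nu> err" using me(3) less_trans less_extended_simps(1) by metis
    ultimately show ?thesis unfolding me(1) by (rule val_add_gt)
  qed
  then have rest: "Fin (X + \<delta>) < \<nu> (\<Sum>j\<in>{..t} - {j0}. T j)" by (intro val_sum_gt) auto
  obtain main err where me: "T j0 = of_nat ((l + j0) choose l) * main + err"
    "\<nu> main = Fin X" "Fin (X + \<delta>) < \<nu> err"
    unfolding T_def X_def using expc_change[OF Q0 Q P \<delta> QP small j0(2)] by blast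
  obtain v where v: "\<nu> (of_nat ((l + j0) choose l)) = Fin v" "v \<le> \<delta>"
    using binom by (cases "\<nu> (of_nat ((l + j0) choose l))") auto
  have "\<nu> (of_nat ((l + j0) choose l) * main) = Fin (v + X)" using v me by (simp add: val_mult)
  moreover have le: "v + X \<le> X + \<delta>" using v by simp
  then have "Fin (v + X) < \<nu> (err + (\<Sum>j\<in>{..t} - {j0}. T j))"
    using val_add_gt[OF me(3) rest] le_less_trans less_eq_extended.simps(1) by metis
  ultimately have "\<nu> (of_nat ((l + j0) choose l) * main + (err + (\<Sum>j\<in>{..t} - {j0}. T j))) = Fin (v + X)"
    by (rule val_add_eq)
  then have "\<nu> (expc Q F l) = Fin (v + X)" unfolding eq me(1) by (simp add: add.assoc)
  then show ?thesis using that le by (simp add: X_def)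
qed

text \<open>\<open>\<gamma> Q\<close> is also the value of \<open>P - Q\<close>, whose degree is
  below \<open>m\<close>.\<close>

lemma value_in_Gamma:
  assumes "Q \<in> Qs" "P \<in> Qs" "\<gamma> Q < \<gamma> P" shows "\<gamma> Q \<in> Gamma \<nu>"
  using key[OF assms(1)] val_diff_Q[OF assms(2,1,3)] degree_diff[OF assms(2,1)] deg[OF assms(1)]
    simple_key_small_val_in_Gamma by metis

end

section \<open>A coefficient of bounded value\<close>

context limit_family begin

lemma exists_coefficient_le:
  assumes shift: "\<And>Q. Q \<in> Qs \<Longrightarrow> \<exists>Q'\<in>Qs. \<gamma> Q + \<delta> < \<gamma> Q'" and \<delta>: "0 \<le> \<delta>"
    and binom: "\<And>N. 0 < N \<Longrightarrow> N \<le> 2 ^ (degree F div m) \<Longrightarrow> \<nu> (of_nat N) \<le> Fin \<delta>"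
    and F: "F \<noteq> 0" and l: "l \<le> degree F div m" and Q0: "Q0 \<in> Qs"
  obtains Q b R where "Q \<in> Qs" "\<gamma> Q0 \<le> \<gamma> Q" "\<nu> (expc Q F l) = Fin b"
    "R \<in> Qs" "Fin (b + nmul l (\<gamma> Q)) \<le> nuQ \<nu> R F"
proof -
  define D t where "D = degree F div m" and "t = D - l"
  have lt: "l + t = D" using l by (simp add: D_def t_def)
  obtain q where q: "\<And>n. q n \<in> Qs" "q 0 = Q0" "\<And>n. \<gamma> (q n) + \<delta> < \<gamma> (q (Suc n))"
    using dependent_nat_choice[of "\<lambda>n x. x \<in> Qs \<and> (n = 0 \<longrightarrow> x = Q0)" "\<lambda>n x y. \<gamma> x + \<delta> < \<gamma> y"] Q0 shift
    by (metis Zero_not_Suc)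
  have mono: "\<gamma> (q k) + \<delta> < \<gamma> (q k')" if "k < k'" for k k'
  proof -
    have "\<gamma> (q n) \<le> \<gamma> (q (Suc n))" for n
      using q(3)[of n] \<delta> by (meson le_add_same_cancel1 le_less_trans less_imp_le)
    from lift_Suc_mono_le[of "\<lambda>n. \<gamma> (q n)", OF this, of "Suc k" k']
    have "\<gamma> (q (Suc k)) \<le> \<gamma> (q k')" using that by simp
    then show ?thesis using q(3)[of k] by simp
  qed
  \<comment> \<open>The chain has \<open>2 * t + 3\<close> candidates between \<open>q 0\<close>,
    whose value bounds the carries, and \<open>P\<close>, whose expansion is the starting
    point.\<close>
  define P where "P = q (2 * t + 4)"
  have P: "P \<in> Qs" using q by (simp add: P_def)
  obtain R where R: "R \<in> Qs" "\<nu> (expc P F D * P ^ D) \<le> nuQ \<nu> R F"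
    using top_term_le[OF P F] unfolding D_def by blast
  \<comment> \<open>\<open>F\<close> is unstable, so its truncated values are finite.\<close>
  have "\<nu> (expc P F D * P ^ D) \<noteq> Pinf"
    using R(2) nuQ_le_val[OF R(1), of F] unstable[OF R(1)] by auto
  then obtain bt where bt: "\<nu> (expc P F D) = Fin bt"
    using val_power[OF val_Q[OF P], of D] by (cases "\<nu> (expc P F D)") (auto simp: val_mult)
  have "Fin (bt + nmul D (\<gamma> P)) \<le> nuQ \<nu> R F"
    using R(2) bt val_power[OF val_Q[OF P], of D] by (simp add: val_mult)
  \<comment> \<open>Moving on from \<open>R\<close> by more than \<open>\<delta>\<close> lets
    \<open>nuQ_growth\<close> absorb the loss from the binomial coefficient.\<close>
  obtain R' where R': "R' \<in> Qs" "\<gamma> R + \<delta> < \<gamma> R'" using shift[OF R(1)] by blast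
  then have R'': "\<gamma> R \<le> \<gamma> R'" using \<delta> by (meson le_add_same_cancel1 le_less_trans less_imp_le)
  have "Fin (bt + nmul D (\<gamma> P) + \<delta>) \<le> Fin (bt + nmul D (\<gamma> P) + (\<gamma> R' - \<gamma> R))"
    using R' by (simp add: algebra_simps less_imp_le)
  also have "\<dots> \<le> nuQ \<nu> R' F" by (rule nuQ_growth) fact+
  finally have top: "Fin (bt + nmul D (\<gamma> P) + \<delta>) \<le> nuQ \<nu> R' F" .
  have bt': "\<nu> (expc P F (l + t)) = Fin bt" using bt lt by simp
  obtain i j0 b0 where i: "i \<in> {1..2 * t + 3}" and j0: "j0 \<le> t" "\<nu> (expc P F (l + j0)) = Fin b0"
    and le: "b0 + nmul j0 (\<gamma> (q i)) \<le> bt + nmul t (\<gamma> (q i))"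
    and dom: "\<And>j. j \<le> t \<Longrightarrow> j \<noteq> j0 \<Longrightarrow> Fin (b0 + nmul j0 (\<gamma> (q i)) + \<delta>) < \<nu> (expc P F (l + j)) + Fin (nmul j (\<gamma> (q i)))"
    using exists_dominant_line[of "\<lambda>j. \<nu> (expc P F (l + j))" t bt \<delta> "\<lambda>n. \<gamma> (q n)", OF val_ne_Minf bt' \<delta> q(3)] by blast
  have lti: "\<gamma> (q 0) + \<delta> < \<gamma> (q i)" "\<gamma> (q i) + \<delta> < \<gamma> P" using mono i by (auto simp: P_def)
  then have ltP: "\<gamma> (q i) < \<gamma> P" using \<delta> by (meson le_add_same_cancel1 le_less_trans)
  have degF: "degree F < Suc (l + t) * m"
  proof -
    have "0 < m" using pos[OF P] deg[OF P] by simp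
    then show ?thesis unfolding lt D_def using dividend_less_div_times[of m "degree F"] by simp
  qed
  have "(l + j0) choose l \<le> 2 ^ (l + j0)" by (rule binomial_le_pow2)
  also have "\<dots> \<le> 2 ^ D" using j0 lt by (intro power_increasing) auto
  finally have "\<nu> (of_nat ((l + j0) choose l)) \<le> Fin \<delta>"
    by (intro binom) (auto simp: D_def)
  then obtain b where b: "\<nu> (expc (q i) F l) = Fin b" "b \<le> b0 + nmul j0 (\<gamma> (q i)) + \<delta>"
    using expc_val_of_dominant[OF q(1) q(1) P \<delta> lti(1) ltP degF j0 _ dom] by blast
  \<comment> \<open>The winning line is at most as high as line \<open>t\<close>, which belongs to
    the top coefficient; passing from \<open>q i\<close> to \<open>P\<close> only increases the
    bound.\<close>
  have "b + nmul l (\<gamma> (q i)) \<le> (bt + nmul t (\<gamma> (q i)) + \<delta>) + nmul l (\<gamma> (q i))"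
    using b(2) le by (meson add_right_mono order_trans)
  also have "\<dots> = bt + nmul D (\<gamma> (q i)) + \<delta>" by (simp add: nmul_add algebra_simps flip: lt)
  also have "\<dots> \<le> bt + nmul D (\<gamma> P) + \<delta>" using ltP by (intro add_mono nmul_mono) auto
  finally have "Fin (b + nmul l (\<gamma> (q i))) \<le> Fin (bt + nmul D (\<gamma> P) + \<delta>)" by simp
  also note top
  finally have "Fin (b + nmul l (\<gamma> (q i))) \<le> nuQ \<nu> R' F" .
  moreover have "\<gamma> Q0 \<le> \<gamma> (q i)"
    using lti(1) \<delta> q(2) by (metis le_add_same_cancel1 le_less_trans less_imp_le)
  ultimately show ?thesis using that q(1) b(1) R'(1) by blast
qed

end

section \<open>Values of integers\<close>

context poly_valuation begin

text \<open>A Bezout relation between distinct primes would give \<open>1\<close> positive value.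
  This makes the definite description in \<open>resexp\<close> meaningful.\<close>

lemma residue_char_unique:
  assumes "prime (q::nat)" "prime r" "\<nu> (of_nat q) > 0" "\<nu> (of_nat r) > 0"
  shows "q = r"
proof (rule ccontr)
  assume "q \<noteq> r"
  then have "coprime q r" using assms by (simp add: primes_coprime)
  moreover have "q \<noteq> 0" using assms(1) by auto
  ultimately obtain x y where "q * x = r * y + 1" using bezout_nat[of q r] by auto
  then have "(of_nat q * of_nat x :: 'k poly) = of_nat r * of_nat y + 1"
    by (metis of_nat_add of_nat_mult of_nat_1)
  then have "1 = (of_nat q * of_nat x :: 'k poly) - of_nat r * of_nat y" by simp
  moreover have "Fin 0 < \<nu> (of_nat q * of_nat x)" "Fin 0 < \<nu> (of_nat r * of_nat y)"
    using val_mult_gt[of 0 _ 0, OF _ val_of_nat_nonneg] assms by (auto simp: zero_extended_def)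
  ultimately have "Fin 0 < \<nu> 1" using val_diff_gt by metis
  then show False by simp
qed

lemma val_prime:
  assumes "prime (r::nat)" "\<nu> (of_nat (resexp \<nu>)) = Fin h"
  shows "\<nu> (of_nat r) = Fin 0 \<or> \<nu> (of_nat r) = Fin h"
proof (cases "\<nu> (of_nat r) > 0")
  case True
  then have "(THE q::nat. prime q \<and> \<nu> (of_nat q) > 0) = r"
    using assms(1) residue_char_unique by (intro the_equality) auto
  then have "resexp \<nu> = r" using True assms(1) by (auto simp: resexp_def)
  then show ?thesis using assms(2) by simp
next
  case False
  then show ?thesis using val_of_nat_nonneg[of r] by (auto simp: zero_extended_def)
qed

text \<open>Split off one prime factor at a time: each contributes \<open>0\<close> or
  \<open>h\<close>.\<close>

lemma val_of_nat_le:
  assumes h: "\<nu> (of_nat (resexp \<nu>)) = Fin h" and N: "0 < N"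
  obtains k where "\<nu> (of_nat N) \<le> Fin (nmul k h)"
proof -
  have h0: "0 \<le> h" using val_of_nat_nonneg[of "resexp \<nu>"] h by simp
  have "\<exists>k. \<nu> (of_nat N) \<le> Fin (nmul k h)" using N
  proof (induction N rule: less_induct)
    case (less N)
    show ?case
    proof (cases "N = 1")
      case True
      then show ?thesis by (auto intro: exI[of _ 0])
    next
      case False
      then obtain r where r: "prime r" "r dvd N" using prime_factor_nat by blast
      then obtain M where M: "N = r * M" by auto
      have "0 < M" "M < N" using less.prems M prime_gt_1_nat[OF r(1)] by (auto simp: M)
      then obtain k where k: "\<nu> (of_nat M) \<le> Fin (nmul k h)" using less.IH by blast
      have "\<nu> (of_nat N) = \<nu> (of_nat r) + \<nu> (of_nat M)" by (simp add: M val_mult)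
      also have "\<dots> \<le> Fin h + Fin (nmul k h)"
        using val_prime[OF r(1) h] h0 k by (intro add_mono) auto
      finally show ?thesis by (intro exI[of _ "Suc k"]) simp
    qed
  qed
  then show ?thesis using that by blast
qed

end

section \<open>Restriction to a final segment and conclusion\<close>

theorem mainTheorem15:
  fixes \<nu> :: "'k::field poly \<Rightarrow> 'g::linordered_ab_group_add extended"
    and m :: nat and Qs :: "'k poly set" and F :: "'k poly"
  assumes div: "divisible_grp TYPE('g)"
    and val: "is_valuation \<nu>"
    and ws: "well_specified \<nu>"
    and m: "m \<ge> 1"
    and Psi_ne: "Psi \<nu> m \<noteq> {}"
    and Psi_nomax: "\<forall>P\<in>Psi \<nu> m. \<exists>R\<in>Psi \<nu> m. \<nu> P < \<nu> R"
    and Qs_sub: "Qs \<subseteq> Psi \<nu> m"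
    and Qs_inj: "inj_on \<nu> Qs"
    and Qs_wf: "wf {(Q, R). Q \<in> Qs \<and> R \<in> Qs \<and> \<nu> Q < \<nu> R}"
    and Qs_cof: "\<forall>P\<in>Psi \<nu> m. \<exists>Q\<in>Qs. \<nu> P \<le> \<nu> Q"
    and unst_ex: "\<exists>f. \<not> stable \<nu> Qs f"
    and F_monic: "lead_coeff F = 1"
    and F_unst: "\<not> stable \<nu> Qs F"
    and F_min: "\<forall>g. lead_coeff g = 1 \<and> \<not> stable \<nu> Qs g \<longrightarrow> degree F \<le> degree g"
    and vunb: "\<not> vert_bounded (gammaL \<nu> Qs)"
    and s1: "eventually_in \<nu> Qs (\<lambda>Q. Ilev \<nu> Q = {1})"
    and vp: "\<nu> (of_nat (resexp \<nu>)) \<in> Fin ` invgroup (Gamma \<nu>) (gammaL \<nu> Qs)"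
  shows "Jset \<nu> Qs m F = {}"
proof (rule ccontr)
  interpret poly_valuation \<nu> by unfold_locales (rule val)
  assume "Jset \<nu> Qs m F \<noteq> {}"
  then obtain l QJ where l: "l \<le> degree F div m" and QJ: "QJ \<in> Qs"
    and J: "\<And>Q. Q \<in> Qs \<Longrightarrow> \<nu> QJ \<le> \<nu> Q \<Longrightarrow> above \<nu> Qs F (\<nu> (expc Q F l) + (\<Sum>i<l. \<nu> Q))"
    by (auto simp: Jset_def eventually_in_def)
  obtain Q1 where Q1: "Q1 \<in> Qs" "\<And>Q. Q \<in> Qs \<Longrightarrow> \<nu> Q1 \<le> \<nu> Q \<Longrightarrow> Ilev \<nu> Q = {1}"
    using s1 by (auto simp: eventually_in_def)
  \<comment> \<open>From \<open>Q1\<close> on, every level is attained exactly at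
    \<open>s = 1\<close>.\<close>
  define Qs' where "Qs' = {Q\<in>Qs. \<nu> Q1 \<le> \<nu> Q}"
  \<comment> \<open>The default \<open>0\<close> does not occur on \<open>Qs\<close>: an element of
    infinite value would be maximal in \<open>Psi \<nu> m\<close>.\<close>
  define \<gamma> where "\<gamma> Q = (case \<nu> Q of Fin x \<Rightarrow> x | _ \<Rightarrow> 0)" for Q
  have fin: "\<nu> Q = Fin (\<gamma> Q)" if "Q \<in> Qs" for Q
  proof -
    have "\<nu> Q \<noteq> Pinf" using Psi_nomax Qs_sub that by fastforce
    then show ?thesis using val_ne_Minf[of Q] by (auto simp: \<gamma>_def split: extended.splits)
  qed
  have \<gamma>_le: "\<gamma> Q \<le> \<gamma> R \<longleftrightarrow> \<nu> Q \<le> \<nu> R" if "Q \<in> Qs" "R \<in> Qs" for Q R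
    using fin[OF that(1)] fin[OF that(2)] by simp
  interpret key_family \<nu> Qs' m \<gamma>
  proof
    fix Q assume Q: "Q \<in> Qs'"
    then have k: "keypoly \<nu> Q" "degree Q = m" using Qs_sub by (auto simp: Qs'_def Psi_def)
    then obtain \<gamma>' d where "simple_key \<nu> Q \<gamma>' d"
      using keypoly_imp_simple_key[of Q] m Q Q1(2) fin[of Q] by (auto simp: Qs'_def)
    moreover have "\<gamma>' = \<gamma> Q" using calculation fin[of Q] Q by (simp add: simple_key_def Qs'_def)
    ultimately show "\<exists>d. simple_key \<nu> Q (\<gamma> Q) d" by auto
    show "degree Q = m" by fact
  qed
  interpret limit_family \<nu> Qs' m \<gamma> F
  proof
    fix R assume R: "R \<in> Qs'"
    \<comment> \<open>By \<open>stable_from\<close>, equality at a single \<open>R\<close> would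
      already make \<open>F\<close> stable.\<close>
    show "nuQ \<nu> R F \<noteq> \<nu> F"
    proof
      assume "nuQ \<nu> R F = \<nu> F"
      then have "nuQ \<nu> Q F = \<nu> F" if "Q \<in> Qs" "\<nu> R \<le> \<nu> Q" for Q
        using that R stable_from[of R Q F] \<gamma>_le[of R Q] by (auto simp: Qs'_def)
      then have "stable \<nu> Qs F" using R by (auto simp: stable_def eventually_in_def Qs'_def)
      then show False using F_unst by simp
    qed
  next
    fix g :: "'k poly" assume "lead_coeff g = 1" "degree g < degree F"
    then have "stable \<nu> Qs g" using F_min by (metis not_le)
    then obtain R0 where R0: "R0 \<in> Qs" "\<And>R. R \<in> Qs \<Longrightarrow> \<nu> R0 \<le> \<nu> R \<Longrightarrow> nuQ \<nu> R g = \<nu> g"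
      by (auto simp: stable_def eventually_in_def)
    \<comment> \<open>The later of \<open>R0\<close> and \<open>Q1\<close>, so that it lies in the
      final segment.\<close>
    define R1 where "R1 = (if \<nu> R0 \<le> \<nu> Q1 then Q1 else R0)"
    have "R1 \<in> Qs'" "\<nu> R0 \<le> \<nu> R1" using R0(1) Q1(1) by (auto simp: R1_def Qs'_def)
    moreover have "nuQ \<nu> R g = \<nu> g" if "R \<in> Qs'" "\<gamma> R1 \<le> \<gamma> R" for R
      using that calculation \<gamma>_le[of R1 R] by (intro R0(2)) (auto simp: Qs'_def)
    ultimately show "\<exists>R0\<in>Qs'. \<forall>R\<in>Qs'. \<gamma> R0 \<le> \<gamma> R \<longrightarrow> nuQ \<nu> R g = \<nu> g" by blast
  qed
  have nomax: "\<exists>Q'\<in>Qs'. \<gamma> Q < \<gamma> Q'" if Q: "Q \<in> Qs'" for Q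
  proof -
    obtain R where "R \<in> Psi \<nu> m" "\<nu> Q < \<nu> R" using Psi_nomax Qs_sub Q by (auto simp: Qs'_def)
    then obtain Q' where Q': "Q' \<in> Qs" "\<nu> Q < \<nu> Q'" using Qs_cof by (meson less_le_trans)
    then have "\<nu> Q1 \<le> \<nu> Q'" using Q by (auto simp: Qs'_def)
    then show ?thesis using Q Q' fin[of Q] fin[of Q'] by (intro bexI[of _ Q']) (auto simp: Qs'_def)
  qed
  obtain h where h: "\<nu> (of_nat (resexp \<nu>)) = Fin h" "h \<in> invgroup (Gamma \<nu>) (gammaL \<nu> Qs)"
    using vp by auto
  have h0: "0 \<le> h" using val_of_nat_nonneg[of "resexp \<nu>"] h(1) by simp
  have shift1: "\<exists>Q'\<in>Qs'. \<gamma> Q + h \<le> \<gamma> Q'" if Q: "Q \<in> Qs'" for Q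
  proof -
    \<comment> \<open>Membership in \<open>Gamma \<nu>\<close> puts the value into the lower set of
      the cut, which is invariant under translation by \<open>h\<close>.\<close>
    have "\<gamma> Q \<in> Gamma \<nu>" using nomax[OF Q] value_in_Gamma[OF Q] by blast
    moreover have "Q \<in> Qs" "Fin (\<gamma> Q) \<le> \<nu> Q" using Q fin[of Q] by (auto simp: Qs'_def)
    ultimately have "\<gamma> Q \<in> gammaL \<nu> Qs" unfolding gammaL_def by blast
    then have "h + \<gamma> Q \<in> gammaL \<nu> Qs" using h(2) by (auto simp: invgroup_def)
    then obtain Q' where Q': "Q' \<in> Qs" "Fin (h + \<gamma> Q) \<le> \<nu> Q'" by (auto simp: gammaL_def)
    then have le: "\<gamma> Q + h \<le> \<gamma> Q'" using fin[of Q'] by (simp add: add.commute)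
    then have "\<gamma> Q \<le> \<gamma> Q'" using h0 by (meson le_add_same_cancel1 order_trans)
    then have "Q' \<in> Qs'" using Q Q'(1) \<gamma>_le[of Q Q'] by (auto simp: Qs'_def)
    then show ?thesis using le by blast
  qed
  \<comment> \<open>Translation by \<open>h\<close> is iterated; strictness comes from the case
    \<open>k = 0\<close>, where the absence of a maximum is used.\<close>
  have shift: "\<exists>Q'\<in>Qs'. \<gamma> Q + nmul k h < \<gamma> Q'" if Q: "Q \<in> Qs'" for Q k
  proof (induction k)
    case 0
    then show ?case using nomax[OF Q] by simp
  next
    case (Suc k)
    then obtain Q' where Q': "Q' \<in> Qs'" "\<gamma> Q + nmul k h < \<gamma> Q'" by blast
    obtain Q'' where Q'': "Q'' \<in> Qs'" "\<gamma> Q' + h \<le> \<gamma> Q''" using shift1[OF Q'(1)] by blast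
    have "\<gamma> Q + nmul (Suc k) h = (\<gamma> Q + nmul k h) + h" by (simp add: algebra_simps)
    also have "\<dots> < \<gamma> Q' + h" using Q'(2) by (rule add_strict_right_mono)
    also note Q''(2)
    finally show ?case using Q''(1) by blast
  qed
  \<comment> \<open>One factorial is divisible by every positive integer up to
    \<open>2 ^ (degree F div m)\<close>, so its value bounds all of theirs at once.\<close>
  obtain k where k: "\<nu> (of_nat (fact (2 ^ (degree F div m)))) \<le> Fin (nmul k h)"
    using val_of_nat_le[OF h(1), of "fact (2 ^ (degree F div m))"] by auto
  have binom: "\<nu> (of_nat N) \<le> Fin (nmul k h)" if N: "0 < N" "N \<le> 2 ^ (degree F div m)" for N
  proof -
    obtain M where M: "fact (2 ^ (degree F div m)) = N * M" using dvd_fact[of N] N by (auto elim: dvdE)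
    have "\<nu> (of_nat (N * M)) = \<nu> (of_nat N) + \<nu> (of_nat M)" by (simp add: val_mult)
    moreover have "\<nu> (of_nat N) + Fin 0 \<le> \<nu> (of_nat N) + \<nu> (of_nat M)"
      using val_of_nat_nonneg[of M] by (intro add_left_mono)
    moreover have "\<nu> (of_nat N) + Fin 0 = \<nu> (of_nat N)" by (cases "\<nu> (of_nat N)") auto
    ultimately show ?thesis using k unfolding M by simp
  qed
  define Q0 where "Q0 = (if \<nu> QJ \<le> \<nu> Q1 then Q1 else QJ)"
  have Q0: "Q0 \<in> Qs'" "\<nu> QJ \<le> \<nu> Q0" using QJ Q1(1) by (auto simp: Q0_def Qs'_def)
  have "F \<noteq> 0" using F_monic by auto
  then obtain Q b R where Q: "Q \<in> Qs'" "\<gamma> Q0 \<le> \<gamma> Q" "\<nu> (expc Q F l) = Fin b"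
    and R: "R \<in> Qs'" "Fin (b + nmul l (\<gamma> Q)) \<le> nuQ \<nu> R F"
    using exists_coefficient_le[OF shift nmul_nonneg[OF h0] binom _ l Q0(1)] by blast
  have "\<nu> QJ \<le> \<nu> Q" using Q Q0 \<gamma>_le[of Q0 Q] by (auto simp: Qs'_def)
  then have "above \<nu> Qs F (\<nu> (expc Q F l) + (\<Sum>i<l. \<nu> Q))" using Q by (intro J) (auto simp: Qs'_def)
  then have "above \<nu> Qs F (Fin (b + nmul l (\<gamma> Q)))" using Q fin[of Q] by (simp add: Qs'_def sum_Fin)
  \<comment> \<open>A finite value that is at most some \<open>nuQ \<nu> R F\<close> cannot lie
    above the cut.\<close>
  then show False using R by (auto simp: above_def deltaL_def Qs'_def)
qed

end
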